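(* Let $X$ be a complex Hilbert space. Let $T \in \mathcal{L}(X)$ be power-bounded, and suppose that $S \in \mathcal{L}(X)$ commutes with $T$. Let $\alpha > 0$ and $k \in \mathbb{N}$ satisfy $k > \alpha$. If $f \colon (0,\infty) \to (0,\infty)$ is $\alpha$-bounded regularly varying, then the following statements are equivalent: (i) $\|T^nS\| = O(1/f(n))$ as $n \to \infty$. (ii) There exists a constant $M>0$ such that $$\|R(\lambda,T)^{k} S\| \leq \frac{M}{(|\lambda|-1)^{k}f(1/(|\lambda|-1))}$$ for all $\lambda \in \mathbb{C}$ with $|\lambda|>1$.
   Context: $\mathcal{L}(X)$ denotes the space of bounded linear operators on $X$. An operator $T \in \mathcal{L}(X)$ is power-bounded if $\sup_{n \ge 0}\|T^n\| < \infty$ (then its spectral radius is at most $1$). For $\lambda$ in the resolvent set of $T$, $R(\lambda,T) = (\lambda I - T)^{-1}$. $\mathbb{N}$ is the set of positive integers. For $\alpha \ge 0$, a function $f \colon (0,\infty) \to (0,\infty)$ is called $\alpha$-bounded regularly varying if there exists $t_0>0$ such that $f$ is non-decreasing on $[t_0,\infty)$, is absolutely continuous on each compact subinterval of $[t_0,\infty)$, and satisfies $t f'(t)/f(t) \le \alpha$ for a.e. $t \ge t_0$. $a(n) = O(b(n))$ as $n\to\infty$ means there are constants $K>0$, $n_0$ with $a(n)\le K b(n)$ for all $n \ge n_0$.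
   Formalization: It is assumed in addition that f is bounded above on (0,b] for every b>0; otherwise (i) does not imply (ii), e.g. X=ℂ, T=0, S=I, k=1, α=1/2, f(t)=1/t for t<1 and f(t)=1 for t≥1. *)

theory Defs
  imports "HOL-Analysis.Analysis" "HOL-Library.Landau_Symbols"
begin

text \<open>
  Complex Hilbert spaces. The library only has real inner product spaces, so the complex structure
  is put on top of \<^class>\<open>real_inner\<close>: the underlying real scalar multiplication and real inner
  product are the restriction of the complex scalar multiplication and the real part of the complex
  inner product. Positive definiteness of \<open>cinner\<close> and \<open>norm x = sqrt (cinner x x)\<close> (note that
  \<open>cinner x x\<close> is real by conjugate symmetry) are then inherited from \<^class>\<open>real_inner\<close>.
\<close>

class complex_inner = real_inner +
  fixes scaleC :: "complex \<Rightarrow> 'a \<Rightarrow> 'a" (infixr \<open>*\<^sub>C\<close> 75)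
    and cinner :: "'a \<Rightarrow> 'a \<Rightarrow> complex"
  assumes scaleC_add_right: "a *\<^sub>C (x + y) = a *\<^sub>C x + a *\<^sub>C y"
    and scaleC_add_left: "(a + b) *\<^sub>C x = a *\<^sub>C x + b *\<^sub>C x"
    and scaleC_scaleC: "a *\<^sub>C b *\<^sub>C x = (a * b) *\<^sub>C x"
    and scaleR_scaleC: "r *\<^sub>R x = complex_of_real r *\<^sub>C x"
    and cinner_commute: "cinner x y = cnj (cinner y x)"
    and cinner_add_left: "cinner (x + y) z = cinner x z + cinner y z"
    and cinner_scaleC_left: "cinner (a *\<^sub>C x) y = a * cinner x y"
    and inner_eq_Re_cinner: "inner x y = Re (cinner x y)"

class complex_hilbert_space = complex_inner + complete_space

instantiation complex :: complex_hilbert_space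
begin

definition scaleC_complex :: "complex \<Rightarrow> complex \<Rightarrow> complex"
  where "scaleC_complex a x = a * x"

definition cinner_complex :: "complex \<Rightarrow> complex \<Rightarrow> complex"
  where "cinner_complex x y = x * cnj y"

instance
  by standard
    (auto simp: scaleC_complex_def cinner_complex_def algebra_simps scaleR_conv_of_real
      inner_complex_def)

end

text \<open>
  Operators are plain functions: composition is \<open>\<circ>\<close>, powers are \<open>^^\<close>, and the operator norm is
  \<^const>\<open>onorm\<close>.
\<close>

definition bounded_clinear :: "('a::complex_inner \<Rightarrow> 'b::complex_inner) \<Rightarrow> bool"
  where "bounded_clinear T \<longleftrightarrow> bounded_linear T \<and> (\<forall>a x. T (a *\<^sub>C x) = a *\<^sub>C T x)"

definition power_bounded :: "('a::complex_inner \<Rightarrow> 'a) \<Rightarrow> bool"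
  where "power_bounded T \<longleftrightarrow> bdd_above (range (\<lambda>n. onorm (T ^^ n)))"

text \<open>Meaningful only for \<open>z\<close> in the resolvent set of \<open>T\<close>.\<close>

definition resolvent :: "complex \<Rightarrow> ('a::complex_inner \<Rightarrow> 'a) \<Rightarrow> 'a \<Rightarrow> 'a"
  where "resolvent z T = inv (\<lambda>x. z *\<^sub>C x - T x)"

text \<open>
  Absolute continuity of a function on \<open>[a, b]\<close>; the library's \<^const>\<open>absolutely_continuous\<close> is about
  measures.
\<close>

definition abs_continuous_on_interval :: "real \<Rightarrow> real \<Rightarrow> (real \<Rightarrow> real) \<Rightarrow> bool"
  where "abs_continuous_on_interval a b f \<longleftrightarrow>
    (\<forall>\<epsilon>>0. \<exists>\<delta>>0. \<forall>(n::nat) u v.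
      (\<forall>i<n. a \<le> u i \<and> u i \<le> v i \<and> v i \<le> b) \<longrightarrow>
      disjoint_family_on (\<lambda>i. {u i<..<v i}) {..<n} \<longrightarrow>
      (\<Sum>i<n. v i - u i) < \<delta> \<longrightarrow>
      (\<Sum>i<n. \<bar>f (v i) - f (u i)\<bar>) < \<epsilon>)"

text \<open>
  A function \<open>(0,\<infinity>) \<rightarrow> (0,\<infinity>)\<close> is a total function that is positive on positive arguments;
  its values at \<open>t \<le> 0\<close> are irrelevant. Apart from positivity nothing is required below \<open>t\<^sub>0\<close>, so \<open>f\<close> may
  be unbounded on \<open>(0, t\<^sub>0)\<close>. The derivative is required to exist almost everywhere (which also follows
  from absolute continuity).
\<close>

definition bounded_regularly_varying :: "real \<Rightarrow> (real \<Rightarrow> real) \<Rightarrow> bool"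
  where "bounded_regularly_varying \<alpha> f \<longleftrightarrow>
    (\<forall>t>0. f t > 0) \<and>
    (\<exists>t\<^sub>0>0. mono_on {t\<^sub>0..} f \<and>
      (\<forall>a b. t\<^sub>0 \<le> a \<and> a \<le> b \<longrightarrow> abs_continuous_on_interval a b f) \<and>
      (AE t in lborel. t\<^sub>0 \<le> t \<longrightarrow>
        (\<exists>D. (f has_real_derivative D) (at t) \<and> t * D / f t \<le> \<alpha>)))"

end

theory Submission
  imports Defs "HOL-Real_Asymp.Real_Asymp"
begin

text \<open>
  The resolvent powers have the expansion
  \<open>R(z,T)\<^sup>m = (\<Sum>n. ((n + m - 1) choose n) z\<^bsup>-n-m\<^esup> T\<^sup>n)\<close>.

  Decay implies the resolvent bound: with \<open>s = 1 / (\<bar>z\<bar> - 1)\<close>, regular variation gives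
  \<open>f s / f n \<le> (s / n) powr \<alpha>\<close> for \<open>n \<le> s\<close>, and \<open>f s / f n \<le> 1\<close> for \<open>n \<ge> s\<close>; inserting this into
  the series leaves \<open>s powr \<alpha> (\<Sum>n\<le>s. n powr (k - 1 - \<alpha>))\<close>, which is of order \<open>s\<^sup>k\<close> because \<open>\<alpha> < k\<close>.

  The resolvent bound implies decay: on the circle \<open>\<bar>z\<bar> = 1 + 1 / N\<close> the identity
  \<open>R\<^bsup>k+1\<^esup> S x = (R\<^sup>k S) (R x)\<close> bounds the norm of the left-hand side by that of \<open>R x\<close>, pointwise. By
  Parseval's identity in the Hilbert space the coefficients \<open>((n + k) choose n) r\<^bsup>-n-k-1\<^esup> T\<^sup>n S x\<close>
  are then square-summable with an explicit bound, and power-boundedness together with the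
  Cauchy-Schwarz inequality over \<open>n < N\<close> turns this into a bound on \<open>T\<^sup>N S x\<close>.
\<close>

section \<open>Bounded regular variation\<close>

text \<open>A one-sided mean value inequality. A fine tagged division controls the increments at
  differentiable tags by the derivative, while tags in the exceptional null set carry so little
  total length that absolute continuity makes their increments negligible.\<close>

lemma abs_continuous_deriv_bound:
  fixes f :: "real \<Rightarrow> real"
  assumes ab: "a \<le> b" and ac: "abs_continuous_on_interval a b f"
    and ae: "AE t in lborel. a \<le> t \<and> t \<le> b \<longrightarrow> (\<exists>D. (f has_real_derivative D) (at t) \<and> D \<le> c)"
  shows "f b - f a \<le> c * (b - a)"
proof (rule field_le_epsilon)
  fix e :: real assume "e > 0"
  \<comment> \<open>Three errors share the budget, each a multiple of \<epsilon>: \<open>1\<close>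
    for the increments at tags in the null set, \<open>\<bar>c\<bar>\<close> for the length missing
    there, \<open>b - a\<close> for the derivative approximation.\<close>
  define \<epsilon> where "\<epsilon> = e / (2 * (1 + \<bar>c\<bar> + (b - a)))"
  have den: "1 + \<bar>c\<bar> + (b - a) > 0" using ab by linarith
  have e0: "\<epsilon> > 0" unfolding \<epsilon>_def using \<open>e > 0\<close> den by simp
  have e_eq: "\<epsilon> * (1 + \<bar>c\<bar> + (b - a)) = e / 2"
    unfolding \<epsilon>_def using den by (simp add: field_simps)
  obtain \<delta>' where d0': "\<delta>' > 0" and ac\<delta>': "\<And>(n::nat) u v.
      (\<forall>i<n. a \<le> u i \<and> u i \<le> v i \<and> v i \<le> b) \<Longrightarrow>
      disjoint_family_on (\<lambda>i. {u i<..<v i}) {..<n} \<Longrightarrow>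
      (\<Sum>i<n. v i - u i) < \<delta>' \<Longrightarrow> (\<Sum>i<n. \<bar>f (v i) - f (u i)\<bar>) < \<epsilon>"
    using ac[unfolded abs_continuous_on_interval_def, rule_format, OF e0] by blast
  \<comment> \<open>\<open>\<delta>'\<close> serves absolute continuity; the bound by \<epsilon>
    keeps the length lost to the null set below \<epsilon>.\<close>
  define \<delta> where "\<delta> = min \<delta>' \<epsilon>"
  have d0: "\<delta> > 0" using d0' e0 by (simp add: \<delta>_def)
  from AE_E3[OF ae] obtain N where N: "N \<in> null_sets lborel" and
    notN: "\<And>t. t \<in> space lborel - N \<Longrightarrow> a \<le> t \<and> t \<le> b \<longrightarrow> (\<exists>D. (f has_real_derivative D) (at t) \<and> D \<le> c)"
    by metis
  have good: "\<exists>D. (f has_real_derivative D) (at t) \<and> D \<le> c" if "t \<notin> N" "a \<le> t" "t \<le> b" for t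
    using notN[of t] that by (simp add: space_lborel)
  have Nl: "N \<in> null_sets lebesgue" using N by (simp add: null_sets_completionI)
  then have "N \<in> sets lebesgue" by auto
  from sets_lebesgue_outer_open[OF this d0] obtain U
    where U: "open U" "N \<subseteq> U" "(U - N) \<in> lmeasurable" "emeasure lebesgue (U - N) < ennreal \<delta>"
    by blast
  have Um: "U \<in> lmeasurable" "measure lebesgue U < \<delta>"
  proof -
    have "U = (U - N) \<union> N" using U(2) by blast
    moreover have "(U - N) \<union> N \<in> lmeasurable"
      by (rule fmeasurable.Un[OF U(3) fmeasurableI_null_sets[OF Nl]])
    ultimately show Um: "U \<in> lmeasurable" by metis
    have "measure lebesgue (U - N) < \<delta>"
      using U(3,4) d0 by (simp add: emeasure_eq_measure2 ennreal_less_iff)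
    then show "measure lebesgue U < \<delta>"
      using measure_Diff_null_set[OF fmeasurableD[OF Um] Nl] by simp
  qed
  have "\<forall>x. \<exists>r>0. (x \<in> N \<longrightarrow> ball x r \<subseteq> U) \<and>
     (x \<notin> N \<longrightarrow> a \<le> x \<longrightarrow> x \<le> b \<longrightarrow>
        (\<forall>u v. u \<le> x \<longrightarrow> x \<le> v \<longrightarrow> u \<in> ball x r \<longrightarrow> v \<in> ball x r \<longrightarrow> f v - f u \<le> (c + \<epsilon>) * (v - u)))"
  proof
    fix x
    show "\<exists>r>0. (x \<in> N \<longrightarrow> ball x r \<subseteq> U) \<and>
     (x \<notin> N \<longrightarrow> a \<le> x \<longrightarrow> x \<le> b \<longrightarrow>
        (\<forall>u v. u \<le> x \<longrightarrow> x \<le> v \<longrightarrow> u \<in> ball x r \<longrightarrow> v \<in> ball x r \<longrightarrow> f v - f u \<le> (c + \<epsilon>) * (v - u)))"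
    proof (cases "x \<in> N")
      case True
      then show ?thesis using U(1,2) by (metis open_contains_ball subsetD)
    next
      case False
      show ?thesis
      proof (cases "a \<le> x \<and> x \<le> b")
        case True
        with good False obtain D where D: "(f has_real_derivative D) (at x)" "D \<le> c" by blast
        from D(1) have "(f has_derivative (\<lambda>h. D * h)) (at x)"
          by (simp add: has_field_derivative_def)
        then obtain r where r: "r > 0"
          "\<And>y. \<bar>y - x\<bar> < r \<Longrightarrow> \<bar>f y - f x - D * (y - x)\<bar> \<le> \<epsilon> * \<bar>y - x\<bar>"
          using e0 unfolding has_derivative_at_alt by (metis real_norm_def)
        \<comment> \<open>Straddle estimate: because the tag separates \<open>u\<close> and
          \<open>v\<close>, the errors at the two ends add up to a multiple of
          \<open>v - u\<close>.\<close>
        have "f v - f u \<le> (c + \<epsilon>) * (v - u)"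
          if "u \<le> x" "x \<le> v" "u \<in> ball x r" "v \<in> ball x r" for u v
        proof -
          have "f v - f x - D * (v - x) \<le> \<epsilon> * (v - x)"
            using r(2)[of v] that by (simp add: dist_real_def)
          moreover have "-(f u - f x - D * (u - x)) \<le> \<epsilon> * (x - u)"
            using r(2)[of u] that by (simp add: dist_real_def)
          ultimately have "f v - f u \<le> (D + \<epsilon>) * (v - u)" by (simp add: algebra_simps)
          also have "\<dots> \<le> (c + \<epsilon>) * (v - u)" using D(2) that by (intro mult_right_mono) auto
          finally show ?thesis .
        qed
        then show ?thesis using r(1) False by blast
      qed (use False zero_less_one in blast)
    qed
  qed
  then obtain r where r: "\<And>x. r x > 0" "\<And>x. x \<in> N \<Longrightarrow> ball x (r x) \<subseteq> U"
    "\<And>x u v. x \<notin> N \<Longrightarrow> a \<le> x \<Longrightarrow> x \<le> b \<Longrightarrow> u \<le> x \<Longrightarrow> x \<le> v \<Longrightarrow> u \<in> ball x (r x) \<Longrightarrow> v \<in> ball x (r x)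
       \<Longrightarrow> f v - f u \<le> (c + \<epsilon>) * (v - u)"
    by metis
  have "gauge (\<lambda>x. ball x (r x))" using r(1) by (simp add: gauge_def)
  from fine_division_exists_real[OF this] obtain p
    where p: "p tagged_division_of {a..b}" "(\<lambda>x. ball x (r x)) fine p" by blast
  note pD = tagged_division_ofD[OF p(1)]
  have K: "Inf K \<le> x \<and> x \<le> Sup K \<and> a \<le> Inf K \<and> Sup K \<le> b \<and> a \<le> x \<and> x \<le> b \<and> K = {Inf K..Sup K} \<and>
      Inf K \<in> ball x (r x) \<and> Sup K \<in> ball x (r x) \<and> K \<subseteq> ball x (r x)" if xK: "(x, K) \<in> p" for x K
  proof -
    obtain l u where lu: "K = {l..u}" using pD(4)[OF xK] by auto
    have "x \<in> K" "K \<subseteq> {a..b}" using pD(2,3)[OF xK] by auto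
    with lu have "l \<le> u" by auto
    with lu have "Inf K = l" "Sup K = u" "l \<in> K" "u \<in> K" by auto
    moreover have sub: "K \<subseteq> ball x (r x)" using p(2) xK by (auto simp: fine_def)
    moreover have "l \<in> ball x (r x)" "u \<in> ball x (r x)" using sub calculation(3,4) by blast+
    ultimately show ?thesis using lu \<open>x \<in> K\<close> \<open>K \<subseteq> {a..b}\<close> by auto
  qed
  \<comment> \<open>Intervals tagged in the null set lie in the small open set \<open>U\<close> and are handled by absolute
    continuity, the others by the derivative bound.\<close>
  define P where "P = {q \<in> p. fst q \<in> N}"
  define Q where "Q = {q \<in> p. fst q \<notin> N}"
  define len where "len = (\<lambda>q::real \<times> real set. Sup (snd q) - Inf (snd q))"
  define inc where "inc = (\<lambda>q::real \<times> real set. f (Sup (snd q)) - f (Inf (snd q)))"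
  have fin: "finite p" "finite P" "finite Q" using pD(1) by (auto simp: P_def Q_def)
  have split: "sum g p = sum g P + sum g Q" for g :: "real \<times> real set \<Rightarrow> real"
  proof -
    have "p = P \<union> Q" "P \<inter> Q = {}" by (auto simp: P_def Q_def)
    then show ?thesis using fin sum.union_disjoint by metis
  qed
  have tot: "sum inc p = f b - f a" "sum len p = b - a"
    using additive_tagged_division_1[OF ab p(1), of f]
      additive_tagged_division_1[OF ab p(1), of "\<lambda>x. x"]
    by (simp_all add: inc_def len_def case_prod_beta')
  have len0: "len q \<ge> 0" if "q \<in> p" for q using K[of "fst q" "snd q"] that by (auto simp: len_def)
  have dis: "disjoint_family_on (\<lambda>q. {Inf (snd q)<..<Sup (snd q)}) P"
    unfolding disjoint_family_on_def
  proof (intro ballI impI)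
    fix q q' assume q: "q \<in> P" "q' \<in> P" "q \<noteq> q'"
    obtain x k x' k' where [simp]: "q = (x, k)" "q' = (x', k')" by (metis surj_pair)
    have "k = {Inf k..Sup k}" "k' = {Inf k'..Sup k'}"
      using K[of x k] K[of x' k'] q by (auto simp: P_def)
    moreover have "interior k \<inter> interior k' = {}"
      using pD(5)[of x k x' k'] q by (auto simp: P_def)
    ultimately show "{Inf (snd q)<..<Sup (snd q)} \<inter> {Inf (snd q')<..<Sup (snd q')} = {}"
      by (metis \<open>q = (x, k)\<close> \<open>q' = (x', k')\<close> interior_atLeastAtMost_real snd_conv)
  qed
  have "sum len P = (\<Sum>q\<in>P. measure lebesgue {Inf (snd q)<..<Sup (snd q)})"
    using len0 by (intro sum.cong) (auto simp: len_def P_def)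
  also have "\<dots> = measure lebesgue (\<Union>q\<in>P. {Inf (snd q)<..<Sup (snd q)})"
  proof (rule measure_finite_Union[OF fin(2) _ dis, symmetric])
    show "emeasure lebesgue {Inf (snd q)<..<Sup (snd q)} \<noteq> \<infinity>" for q :: "real \<times> real set"
      using fmeasurableD2[OF lmeasurable_box[of "Inf (snd q)" "Sup (snd q)"]] by simp
  qed auto
  also have "\<dots> \<le> measure lebesgue U"
  proof (rule measure_mono_fmeasurable)
    have "open (\<Union>q\<in>P. {Inf (snd q)<..<Sup (snd q)})" by auto
    then show "(\<Union>q\<in>P. {Inf (snd q)<..<Sup (snd q)}) \<in> sets lebesgue" by (simp add: borel_open)
    show "(\<Union>q\<in>P. {Inf (snd q)<..<Sup (snd q)}) \<subseteq> U"
    proof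
      fix y assume "y \<in> (\<Union>q\<in>P. {Inf (snd q)<..<Sup (snd q)})"
      then obtain x k where q: "(x, k) \<in> p" "x \<in> N" "Inf k < y" "y < Sup k"
        by (auto simp: P_def)
      then have "y \<in> k" using K[OF q(1)] by (metis atLeastAtMost_iff less_eq_real_def)
      then show "y \<in> U" using K[OF q(1)] r(2)[OF q(2)] by blast
    qed
  qed (use Um in auto)
  finally have lenP: "sum len P < \<delta>" using Um by simp
  have "sum inc P \<le> \<epsilon>"
  proof -
    obtain h where h: "bij_betw h {..<card P} P"
      using ex_bij_betw_nat_finite[OF fin(2)] by (auto simp: atLeast0LessThan)
    have hP: "h i \<in> P" if "i < card P" for i using h that by (auto simp: bij_betw_def)
    have "(\<Sum>i<card P. \<bar>f (Sup (snd (h i))) - f (Inf (snd (h i)))\<bar>) < \<epsilon>"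
    proof (rule ac\<delta>')
      show "\<forall>i<card P. a \<le> Inf (snd (h i)) \<and> Inf (snd (h i)) \<le> Sup (snd (h i)) \<and> Sup (snd (h i)) \<le> b"
        using hP K unfolding P_def by (smt (verit) mem_Collect_eq prod.collapse)
      show "disjoint_family_on (\<lambda>i. {Inf (snd (h i))<..<Sup (snd (h i))}) {..<card P}"
        using dis hP bij_betw_imp_inj_on[OF h] unfolding disjoint_family_on_def
        by (metis inj_onD lessThan_iff)
      have "(\<Sum>i<card P. len (h i)) = sum len P" using sum.reindex_bij_betw[OF h] by blast
      then show "(\<Sum>i<card P. Sup (snd (h i)) - Inf (snd (h i))) < \<delta>'"
        using lenP by (simp add: len_def \<delta>_def)
    qed
    moreover have "(\<Sum>i<card P. inc (h i)) = sum inc P" using sum.reindex_bij_betw[OF h] by blast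
    moreover have "(\<Sum>i<card P. inc (h i)) \<le> (\<Sum>i<card P. \<bar>f (Sup (snd (h i))) - f (Inf (snd (h i)))\<bar>)"
      by (intro sum_mono) (simp add: inc_def)
    ultimately show ?thesis by linarith
  qed
  moreover have "sum inc Q \<le> (c + \<epsilon>) * sum len Q"
    unfolding sum_distrib_left
  proof (rule sum_mono)
    fix q assume "q \<in> Q"
    then have "(fst q, snd q) \<in> p" "fst q \<notin> N" by (auto simp: Q_def)
    then show "inc q \<le> (c + \<epsilon>) * len q"
      using K[of "fst q" "snd q"] r(3)[of "fst q" "Inf (snd q)" "Sup (snd q)"] by (simp add: inc_def len_def)
  qed
  \<comment> \<open>The intervals in \<open>Q\<close> fill \<open>{a..b}\<close> up to length
    \<epsilon>; since the sign of \<open>c\<close> is arbitrary, the defect is charged with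
    \<open>\<bar>c\<bar>\<close>.\<close>
  moreover have "c * sum len Q \<le> c * (b - a) + \<bar>c\<bar> * \<epsilon>"
  proof -
    have "sum len P \<ge> 0" using len0 by (auto simp: P_def intro: sum_nonneg)
    have "- c * sum len P \<le> \<bar>c\<bar> * sum len P" using \<open>sum len P \<ge> 0\<close> by (intro mult_right_mono) auto
    also have "\<dots> \<le> \<bar>c\<bar> * \<epsilon>" using lenP by (intro mult_left_mono) (auto simp: \<delta>_def)
    moreover have "c * sum len Q = c * (b - a) + (- c * sum len P)"
      using split[of len] tot by (simp add: algebra_simps)
    ultimately show ?thesis by linarith
  qed
  moreover have "\<epsilon> * sum len Q \<le> \<epsilon> * (b - a)"
  proof -
    have "sum len P \<ge> 0" using len0 by (auto simp: P_def intro: sum_nonneg)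
    then show ?thesis using split[of len] tot e0 by (intro mult_left_mono) auto
  qed
  ultimately have "f b - f a \<le> c * (b - a) + \<epsilon> * (1 + \<bar>c\<bar> + (b - a))"
    using split[of inc] tot by (simp add: algebra_simps)
  then show "f b - f a \<le> c * (b - a) + e" using e_eq \<open>e > 0\<close> by linarith
qed

text \<open>
  On a short interval \<open>[a, q a]\<close> monotonicity turns the bound on the logarithmic derivative into
  \<open>f (q a) (1 - \<alpha> (q - 1)) \<le> f a\<close>; iterating with \<open>q = (s / t) powr (1 / n)\<close> and letting \<open>n\<close> grow
  avoids absolute continuity of \<open>ln \<circ> f\<close>.
\<close>

lemma bounded_regularly_varying_growth:
  assumes "bounded_regularly_varying \<alpha> f" "\<alpha> > 0"
  obtains t\<^sub>0 where "t\<^sub>0 > 0" "mono_on {t\<^sub>0..} f"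
    "\<And>t s. t\<^sub>0 \<le> t \<Longrightarrow> t \<le> s \<Longrightarrow> f s \<le> f t * (s / t) powr \<alpha>"
proof -
  from assms obtain t\<^sub>0 where pos: "\<And>t. t > 0 \<Longrightarrow> f t > 0" and t0: "t\<^sub>0 > 0" and mono: "mono_on {t\<^sub>0..} f"
    and ac: "\<And>a b. t\<^sub>0 \<le> a \<Longrightarrow> a \<le> b \<Longrightarrow> abs_continuous_on_interval a b f"
    and ae: "AE t in lborel. t\<^sub>0 \<le> t \<longrightarrow> (\<exists>D. (f has_real_derivative D) (at t) \<and> t * D / f t \<le> \<alpha>)"
    unfolding bounded_regularly_varying_def by blast
  have step: "f b * (1 - \<alpha> * (q - 1)) \<le> f a" if "t\<^sub>0 \<le> a" "q \<ge> 1" "b = q * a" for a b q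
  proof -
    have a0: "a > 0" using t0 that by linarith
    then have ab: "a \<le> b" using that by simp
    \<comment> \<open>On \<open>{a..b}\<close> the derivative bound
      \<open>\<alpha> * f t / t\<close> is made constant: monotonicity raises \<open>f t\<close> to
      \<open>f b\<close>, and \<open>t \<ge> a\<close>.\<close>
    have "f b - f a \<le> (\<alpha> * f b / a) * (b - a)"
    proof (rule abs_continuous_deriv_bound[OF ab ac[OF that(1) ab]])
      show "AE t in lborel. a \<le> t \<and> t \<le> b \<longrightarrow> (\<exists>D. (f has_real_derivative D) (at t) \<and> D \<le> \<alpha> * f b / a)"
        using ae
      proof eventually_elim
        case (elim t)
        show ?case
        proof
          assume t: "a \<le> t \<and> t \<le> b"
          with elim that obtain D where D: "(f has_real_derivative D) (at t)" "t * D / f t \<le> \<alpha>" by auto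
          have "t > 0" using t a0 by linarith
          then have "D \<le> \<alpha> * f t / t" using D(2) pos[of t] by (simp add: field_simps)
          also have "\<dots> \<le> \<alpha> * f b / a"
          proof (rule frac_le)
            have "f t \<le> f b" using t that(1) mono by (auto simp: mono_on_def)
            then show "\<alpha> * f t \<le> \<alpha> * f b" "0 \<le> \<alpha> * f b"
              using assms(2) pos[of t] \<open>t > 0\<close> by auto
          qed (use t a0 in auto)
          finally show "\<exists>D. (f has_real_derivative D) (at t) \<and> D \<le> \<alpha> * f b / a" using D(1) by blast
        qed
      qed
    qed
    moreover have "(\<alpha> * f b / a) * (b - a) = \<alpha> * f b * (q - 1)"
      using a0 that(3) by (simp add: field_simps)
    ultimately show ?thesis by (simp add: algebra_simps)
  qed
  have main: "f s \<le> f t * (s / t) powr \<alpha>" if "t\<^sub>0 \<le> t" "t \<le> s" for t s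
  proof -
    have tp: "t > 0" using t0 that by linarith
    define x where "x = s / t"
    have x1: "x \<ge> 1" using that tp by (simp add: x_def)
    \<comment> \<open>Since \<open>x powr (1 / n) - 1\<close> behaves like \<open>ln x / n\<close>,
      the limit is \<open>exp (- \<alpha> * ln x)\<close>.\<close>
    have lim: "(\<lambda>n::nat. (1 - \<alpha> * (x powr (1 / real n) - 1)) ^ n) \<longlonglongrightarrow> x powr - \<alpha>"
    proof -
      have "(\<lambda>n::nat. (1 - \<alpha> * (x powr (1 / real n) - 1)) ^ n) \<longlonglongrightarrow> exp (- (\<alpha> * ln x))"
        using x1 assms(2) by real_asymp
      then show ?thesis using x1 by (simp add: powr_def)
    qed
    have "((\<lambda>n::nat. 1 - \<alpha> * (x powr (1 / real n) - 1)) \<longlongrightarrow> 1) at_top"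
      using x1 assms(2) by real_asymp
    \<comment> \<open>A positive factor is what allows the one-step inequalities to be multiplied
      together in the induction below.\<close>
    then have ev: "eventually (\<lambda>n::nat. 1 - \<alpha> * (x powr (1 / real n) - 1) > 0) at_top"
      by (rule order_tendstoD) simp
    have "f s * x powr - \<alpha> \<le> f t"
    proof (rule tendsto_upperbound[OF tendsto_mult_left[OF lim]])
      show "\<forall>\<^sub>F n::nat in at_top. f s * (1 - \<alpha> * (x powr (1 / real n) - 1)) ^ n \<le> f t"
        using ev eventually_gt_at_top[of 0]
      proof eventually_elim
        case (elim n)
        define q where "q = x powr (1 / real n)"
        have q1: "q \<ge> 1" using x1 by (simp add: q_def ge_one_powr_ge_zero)
        have qn: "q ^ n = x" using elim x1
          by (simp add: q_def powr_realpow[symmetric] powr_powr)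
        have "f (q ^ i * t) * (1 - \<alpha> * (q - 1)) ^ i \<le> f t" for i
        proof (induction i)
          case (Suc i)
          have "t \<le> q ^ i * t" using q1 tp by simp
          with that have "t\<^sub>0 \<le> q ^ i * t" by linarith
          from step[OF this q1, of "q ^ Suc i * t"]
          have "f (q ^ Suc i * t) * (1 - \<alpha> * (q - 1)) \<le> f (q ^ i * t)" by simp
          then have "f (q ^ Suc i * t) * (1 - \<alpha> * (q - 1)) * (1 - \<alpha> * (q - 1)) ^ i
              \<le> f (q ^ i * t) * (1 - \<alpha> * (q - 1)) ^ i"
            using elim by (intro mult_right_mono) (auto simp: q_def)
          with Suc show ?case by (simp add: mult.assoc)
        qed simp
        from this[of n] show ?case using qn tp by (simp add: x_def q_def)
      qed
    qed simp
    then show ?thesis using x1 by (simp add: x_def[symmetric] powr_minus field_simps)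
  qed
  show ?thesis by (rule that[OF t0 mono main])
qed

section \<open>Negative binomial series\<close>

text \<open>Hockey-stick identity. Truncated subtraction covers \<open>m = 0\<close>, where only the
  summand \<open>i = 0\<close> is nonzero.\<close>

lemma sum_negative_binomial: "(\<Sum>i\<le>n. (i + m - 1) choose i) = (n + m) choose n"
  by (induction n) simp_all

text \<open>Induction on the exponent: one more factor \<open>1 / (1 - x)\<close> is a Cauchy
  product with the geometric series, which replaces the coefficients by their partial sums.\<close>

lemma negative_binomial_sums:
  fixes x :: real
  assumes "0 \<le> x" "x < 1"
  shows "(\<lambda>n. real ((n + m - 1) choose n) * x ^ n) sums (1 / (1 - x)) ^ m"
proof (induction m)
  case 0
  have "(\<lambda>n. real ((n + 0 - 1) choose n) * x ^ n) = (\<lambda>n. if n = 0 then 1 else 0)"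
    by (auto simp: fun_eq_iff)
  then show ?case using sums_single[of 0 "\<lambda>_. 1::real"] by simp
next
  case (Suc m)
  let ?a = "\<lambda>n. real ((n + m - 1) choose n) * x ^ n"
  have geo: "(\<lambda>n. x ^ n) sums (1 / (1 - x))" using geometric_sums[of x] assms by simp
  have "(\<lambda>k. \<Sum>i\<le>k. ?a i * x ^ (k - i)) sums (suminf ?a * suminf (\<lambda>n. x ^ n))"
    using Suc geo assms by (intro Cauchy_product_sums) (auto simp: sums_iff abs_mult)
  moreover have "(\<Sum>i\<le>k. ?a i * x ^ (k - i)) = real ((k + Suc m - 1) choose k) * x ^ k" for k
  proof -
    have "(\<Sum>i\<le>k. ?a i * x ^ (k - i)) = (\<Sum>i\<le>k. real ((i + m - 1) choose i) * x ^ k)"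
      by (intro sum.cong) (auto simp: mult.assoc power_add[symmetric])
    then show ?thesis
      using sum_negative_binomial[of m k] by (simp add: sum_distrib_right[symmetric] of_nat_sum[symmetric] del: of_nat_sum)
  qed
  ultimately show ?case using Suc geo by (simp add: sums_iff mult.commute)
qed

text \<open>The negative binomial series at \<open>1 / r\<close>. Its terms are the moduli of the
  coefficients of the \<open>m\<close>-th resolvent power on the circle of radius \<open>r\<close>,
  and norm bounds for resolvent powers reduce to it.\<close>

lemma resolvent_weight_sums:
  assumes "r > 1"
  shows "(\<lambda>n. real ((n + m - 1) choose n) * (1 / r) ^ (n + m)) sums (1 / (r - 1) ^ m)"
proof -
  have "(\<lambda>n. real ((n + m - 1) choose n) * (1 / r) ^ n * (1 / r) ^ m)
      sums ((1 / (1 - 1 / r)) ^ m * (1 / r) ^ m)"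
    using assms by (intro sums_mult2 negative_binomial_sums) auto
  moreover have "(1 / (1 - 1 / r)) * (1 / r) = 1 / (r - 1)" using assms by (simp add: field_simps)
  ultimately show ?thesis
    by (simp add: power_add mult.assoc power_mult_distrib[symmetric] power_one_over)
qed

section \<open>Power sums and polynomial bounds for binomial coefficients\<close>

lemma sum_powr_le:
  fixes \<gamma> :: real
  assumes "0 < \<gamma>" "\<gamma> \<le> 1"
  shows "(\<Sum>n<N. (real n + 1) powr (\<gamma> - 1)) \<le> real N powr \<gamma> / \<gamma>"
proof (induction N)
  case (Suc N)
  have "(real N + 1) powr (\<gamma> - 1) \<le> ((real N + 1) powr \<gamma> - real N powr \<gamma>) / \<gamma>"
  \<comment> \<open>For \<open>N > 0\<close> the mean value theorem compares the summand with the
    increment of \<open>x powr \<gamma> / \<gamma>\<close>, whose derivative is non-increasing. At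
    \<open>0\<close> differentiability may fail, but the claim there is just
    \<open>1 \<le> 1 / \<gamma>\<close>.\<close>
  proof (cases "N = 0")
    case True
    then show ?thesis using assms by simp
  next
    case False
    have "\<exists>x. real N < x \<and> x < real N + 1 \<and>
        (real N + 1) powr \<gamma> - real N powr \<gamma> = (real N + 1 - real N) * (\<gamma> * x powr (\<gamma> - 1))"
      using False by (intro MVT2) (auto intro!: derivative_eq_intros simp: field_simps powr_diff)
    then obtain x where x: "real N < x" "x < real N + 1"
      "(real N + 1) powr \<gamma> - real N powr \<gamma> = \<gamma> * x powr (\<gamma> - 1)" by auto
    have "(real N + 1) powr (\<gamma> - 1) \<le> x powr (\<gamma> - 1)"
      using x assms by (intro powr_mono2') auto
    then show ?thesis using x(3) assms by simp
  qed
  with Suc show ?case by (simp add: diff_divide_distrib add.commute)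
qed simp

text \<open>The hockey-stick identity writes the coefficient of order \<open>Suc j\<close> as a sum
  of \<open>n + 1\<close> coefficients of order \<open>j\<close>, each at most
  \<open>(n + 1) ^ j\<close>.\<close>

lemma binomial_le_power: "((n + j) choose n) \<le> (n + 1) ^ j"
proof (induction j arbitrary: n)
  case (Suc j)
  have "((n + Suc j) choose n) = (\<Sum>i\<le>n. (i + j) choose i)"
    using sum_negative_binomial[of "Suc j" n] by simp
  also have "\<dots> \<le> (\<Sum>i\<le>n. (n + 1) ^ j)"
    by (intro sum_mono order_trans[OF Suc.IH] power_mono) auto
  finally show ?case by simp
qed simp

text \<open>A lower bound of the same order as \<open>binomial_le_power\<close>, by the absorption
  identity. It makes the sum of the first \<open>N\<close> weights at least a constant times
  \<open>N ^ Suc k\<close>.\<close>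

lemma power_le_fact_binomial: "Suc n ^ j \<le> fact j * ((n + j) choose j)"
proof (induction j)
  case (Suc j)
  have "Suc n ^ Suc j \<le> Suc (n + j) * (fact j * ((n + j) choose j))"
    unfolding power_Suc using Suc by (intro mult_mono) auto
  also have "\<dots> = fact j * (Suc (n + j) * ((n + j) choose j))" by (simp only: mult_ac)
  also have "\<dots> = fact (Suc j) * ((n + Suc j) choose Suc j)"
    by (simp only: Suc_times_binomial_eq fact_Suc of_nat_id mult_ac add_Suc_right)
  finally show ?case .
qed simp

text \<open>The bracketed factor majorizes \<open>f s / f n\<close> up to a constant: regular
  variation below \<open>s\<close>, monotonicity above. Its summand \<open>1\<close> contributes
  exactly \<open>s ^ k\<close>, the rest a finite sum of order \<open>s ^ k\<close>. The condition
  \<open>real k - 1 \<le> \<alpha>\<close> places the exponent \<open>k - 1 - \<alpha>\<close> in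
  the range of \<open>sum_powr_le\<close>.\<close>

lemma weighted_series_bound:
  fixes r s \<alpha> :: real
  assumes "r > 1" and s: "s = 1 / (r - 1)" and k: "k \<ge> 1" "real k - 1 \<le> \<alpha>" "\<alpha> < real k"
  obtains B where
    "(\<lambda>n. real ((n + k - 1) choose n) * (1 / r) ^ (n + k) *
        (1 + (if real n + 1 \<le> s then (s / (real n + 1)) powr \<alpha> else 0))) sums B"
    "B \<le> (1 + 1 / (real k - \<alpha>)) * s ^ k"
proof -
  define W where "W n = real ((n + k - 1) choose n) * (1 / r) ^ (n + k)" for n
  define N where "N = nat \<lfloor>s\<rfloor>"
  have s0: "s > 0" using assms by simp
  have N: "real n + 1 \<le> s \<longleftrightarrow> n < N" for n
  proof -
    have "real n + 1 \<le> s \<longleftrightarrow> real_of_int (int n + 1) \<le> s" by simp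
    also have "\<dots> \<longleftrightarrow> int n + 1 \<le> \<lfloor>s\<rfloor>" by (rule le_floor_iff[symmetric])
    also have "\<dots> \<longleftrightarrow> n < N" unfolding N_def by linarith
    finally show ?thesis .
  qed
  have "W sums s ^ k"
    using resolvent_weight_sums[OF assms(1), of k] by (simp add: W_def[abs_def] s power_one_over)
  moreover have "(\<lambda>n. W n * (if real n + 1 \<le> s then (s / (real n + 1)) powr \<alpha> else 0))
      sums (\<Sum>n<N. W n * (s / (real n + 1)) powr \<alpha>)"
    using sums_If_finite_set[of "{..<N}" "\<lambda>n. W n * (s / (real n + 1)) powr \<alpha>"]
    by (simp add: N if_distrib cong: if_cong)
  ultimately have "(\<lambda>n. W n + W n * (if real n + 1 \<le> s then (s / (real n + 1)) powr \<alpha> else 0))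
      sums (s ^ k + (\<Sum>n<N. W n * (s / (real n + 1)) powr \<alpha>))" by (rule sums_add)
  then have "(\<lambda>n. W n * (1 + (if real n + 1 \<le> s then (s / (real n + 1)) powr \<alpha> else 0)))
      sums (s ^ k + (\<Sum>n<N. W n * (s / (real n + 1)) powr \<alpha>))" by (simp only: distrib_left mult_1_right)
  moreover have "(\<Sum>n<N. W n * (s / (real n + 1)) powr \<alpha>) \<le> s ^ k / (real k - \<alpha>)"
  proof -
    define \<gamma> where "\<gamma> = real k - \<alpha>"
    have \<gamma>: "0 < \<gamma>" "\<gamma> \<le> 1" using k by (auto simp: \<gamma>_def)
    \<comment> \<open>Here \<open>W n\<close> is bounded by \<open>(n + 1) ^ (k - 1)\<close>, the
      geometric factor being at most \<open>1\<close>; the powers of \<open>n + 1\<close> then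
      combine to the exponent \<open>\<gamma> - 1\<close>.\<close>
    have "W n * (s / (real n + 1)) powr \<alpha> \<le> s powr \<alpha> * (real n + 1) powr (\<gamma> - 1)" for n
    proof -
      obtain j where j: "k = Suc j" using k(1) by (cases k) auto
      have "real ((n + k - 1) choose n) \<le> real ((n + 1) ^ j)"
        unfolding of_nat_le_iff using binomial_le_power[of n j] j by simp
      moreover have "(1 / r) ^ (n + k) \<le> 1" using assms(1) by (intro power_le_one) auto
      ultimately have "W n \<le> (real n + 1) ^ j * 1"
        unfolding W_def using assms(1) by (intro mult_mono) (auto simp: add.commute)
      then have "W n * (s / (real n + 1)) powr \<alpha> \<le> (real n + 1) ^ j * (s / (real n + 1)) powr \<alpha>"
        by (intro mult_right_mono) auto
      also have "\<dots> = s powr \<alpha> * ((real n + 1) powr real j / (real n + 1) powr \<alpha>)"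
        using s0 by (simp add: powr_divide powr_realpow add_nonneg_pos)
      also have "\<dots> = s powr \<alpha> * (real n + 1) powr (\<gamma> - 1)"
        by (simp add: \<gamma>_def j powr_diff[symmetric] algebra_simps)
      finally show ?thesis .
    qed
    then have "(\<Sum>n<N. W n * (s / (real n + 1)) powr \<alpha>)
        \<le> s powr \<alpha> * (\<Sum>n<N. (real n + 1) powr (\<gamma> - 1))"
      unfolding sum_distrib_left by (intro sum_mono)
    also have "\<dots> \<le> s powr \<alpha> * (real N powr \<gamma> / \<gamma>)"
      by (intro mult_left_mono sum_powr_le \<gamma>) auto
    also have "\<dots> \<le> s powr \<alpha> * (s powr \<gamma> / \<gamma>)"
      using s0 \<gamma> by (intro mult_left_mono divide_right_mono powr_mono2) (auto simp: N_def)
    also have "\<dots> = s ^ k / \<gamma>"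
      using s0 by (simp add: \<gamma>_def powr_add[symmetric] powr_realpow)
    finally show ?thesis by (simp add: \<gamma>_def)
  qed
  ultimately show ?thesis
    by (intro that) (auto simp: W_def algebra_simps)
qed

section \<open>Complex Hilbert spaces and Parseval\<close>

instance complex_hilbert_space \<subseteq> banach ..

lemma norm_scaleC: "norm (a *\<^sub>C x) = cmod a * norm (x :: 'a::complex_inner)"
proof -
  have "cinner (a *\<^sub>C x) (a *\<^sub>C x) = a * cnj (a * cinner x x)"
    by (metis cinner_commute cinner_scaleC_left)
  also have "\<dots> = complex_of_real ((cmod a)\<^sup>2) * cinner x x"
    by (metis cinner_commute complex_cnj_mult complex_norm_square mult.assoc)
  finally have "(norm (a *\<^sub>C x))\<^sup>2 = (cmod a * norm x)\<^sup>2"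
    by (simp add: power2_norm_eq_inner inner_eq_Re_cinner power_mult_distrib)
  then show ?thesis by (simp add: power2_eq_iff_nonneg)
qed

lemma bounded_linear_scaleC: "bounded_linear (\<lambda>x :: 'a::complex_inner. a *\<^sub>C x)"
proof (rule bounded_linear_intro)
  fix r :: real and x :: 'a
  show "a *\<^sub>C (r *\<^sub>R x) = r *\<^sub>R a *\<^sub>C x" by (simp add: scaleR_scaleC scaleC_scaleC mult.commute)
  show "norm (a *\<^sub>C x) \<le> norm x * cmod a" by (simp add: norm_scaleC mult.commute)
qed (simp add: scaleC_add_right)

lemma scaleC_one: "1 *\<^sub>C x = (x :: 'a::complex_inner)"
  by (metis of_real_1 scaleR_one scaleR_scaleC)

lemma scaleC_zero: "0 *\<^sub>C x = (0 :: 'a::complex_inner)"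
  by (metis of_real_0 scaleR_zero_left scaleR_scaleC)

lemma scaleC_diff_left: "(a - b) *\<^sub>C x = a *\<^sub>C x - b *\<^sub>C (x :: 'a::complex_inner)"
  by (metis add_diff_cancel_right' diff_add_cancel scaleC_add_left)

lemma bounded_linear_funpow:
  fixes T :: "'a::real_normed_vector \<Rightarrow> 'a"
  assumes "bounded_linear T"
  shows "bounded_linear (T ^^ n)"
proof (induction n)
  case 0
  then show ?case by (simp add: id_def bounded_linear_ident)
next
  case (Suc n)
  then show ?case using bounded_linear_compose[OF assms] by (simp add: comp_def)
qed

text \<open>Orthogonality of the exponentials, for real parts because the inner product behind the
  norm is real. The constant \<open>c\<close> stays inside, since taking real parts does not commute
  with multiplying by it.\<close>

lemma has_integral_cis:
  "((\<lambda>t. Re (cis (of_int j * t) * c)) has_integral (if j = 0 then 2 * pi * Re c else 0)) {0..2 * pi}"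
proof (cases "j = 0")
  case True
  then show ?thesis using has_integral_const_real[of "Re c" 0 "2 * pi"] by simp
next
  case False
  let ?F = "\<lambda>t. (sin (of_int j * t) * Re c + cos (of_int j * t) * Im c) / of_int j"
  have "((\<lambda>t. Re (cis (of_int j * t) * c)) has_integral (?F (2 * pi) - ?F 0)) {0..2 * pi}"
  proof (rule fundamental_theorem_of_calculus)
    fix t :: real
    have "(?F has_real_derivative Re (cis (of_int j * t) * c)) (at t within {0..2 * pi})"
      using False by (auto intro!: derivative_eq_intros simp: field_simps)
    then show "(?F has_vector_derivative Re (cis (of_int j * t) * c)) (at t within {0..2 * pi})"
      by (simp add: has_real_derivative_iff_has_vector_derivative)
  qed simp
  moreover have "of_int j * (2 * pi) = 2 * pi * of_int j" by simp
  ultimately show ?thesis using False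
    by (simp add: sin_int_2pin cos_int_2pin del: mult_cancel_left mult_cancel_right)
qed

text \<open>Conjugation in the second argument reverses the sign of its frequency, so each cross
  term oscillates with the integer frequency \<open>m - n\<close>.\<close>

lemma inner_scaleC_cis:
  fixes x y :: "'a::complex_inner"
  shows "inner (cis (- (real n * t)) *\<^sub>C x) (cis (- (real m * t)) *\<^sub>C y)
    = Re (cis (of_int (int m - int n) * t) * cinner x y)"
proof -
  have "cinner (cis (- (real n * t)) *\<^sub>C x) (cis (- (real m * t)) *\<^sub>C y)
      = cis (- (real n * t)) * cnj (cis (- (real m * t)) * cnj (cinner x y))"
    by (metis cinner_commute cinner_scaleC_left complex_cnj_cnj)
  also have "\<dots> = cis (of_int (int m - int n) * t) * cinner x y"
    unfolding complex_cnj_mult complex_cnj_cnj cis_cnj mult.assoc[symmetric] cis_mult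
    by (simp add: left_diff_distrib)
  finally show ?thesis by (simp add: inner_eq_Re_cinner)
qed

lemma parseval_finite:
  fixes a :: "nat \<Rightarrow> 'a::complex_inner"
  shows "((\<lambda>t. (norm (\<Sum>n<N. cis (- (real n * t)) *\<^sub>C a n))\<^sup>2)
    has_integral (2 * pi * (\<Sum>n<N. (norm (a n))\<^sup>2))) {0..2 * pi}"
proof -
  have "((\<lambda>t. \<Sum>n<N. \<Sum>m<N. Re (cis (of_int (int m - int n) * t) * cinner (a n) (a m)))
      has_integral (\<Sum>n<N. \<Sum>m<N. if int m - int n = 0 then 2 * pi * Re (cinner (a n) (a m)) else 0)) {0..2 * pi}"
    by (intro has_integral_sum has_integral_cis finite_lessThan)
  moreover have "(\<Sum>n<N. \<Sum>m<N. if int m - int n = 0 then 2 * pi * Re (cinner (a n) (a m)) else 0)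
      = 2 * pi * (\<Sum>n<N. (norm (a n))\<^sup>2)"
    unfolding sum_distrib_left
  proof (rule sum.cong[OF refl])
    fix n assume "n \<in> {..<N}"
    have "(\<Sum>m<N. if int m - int n = 0 then 2 * pi * Re (cinner (a n) (a m)) else 0)
        = (\<Sum>m<N. if n = m then 2 * pi * Re (cinner (a n) (a m)) else 0)"
      by (intro sum.cong) auto
    then show "(\<Sum>m<N. if int m - int n = 0 then 2 * pi * Re (cinner (a n) (a m)) else 0)
        = 2 * pi * (norm (a n))\<^sup>2"
      using \<open>n \<in> {..<N}\<close> by (simp add: power2_norm_eq_inner inner_eq_Re_cinner)
  qed
  moreover have "(norm (\<Sum>n<N. cis (- (real n * t)) *\<^sub>C a n))\<^sup>2
      = (\<Sum>n<N. \<Sum>m<N. Re (cis (of_int (int m - int n) * t) * cinner (a n) (a m)))" for t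
    unfolding power2_norm_eq_inner inner_sum_left unfolding inner_sum_right inner_scaleC_cis ..
  ultimately show ?thesis by (simp only:)
qed

text \<open>Absolute summability bounds all partial sums uniformly by \<open>B\<close>, so dominated
  convergence carries the finite identity to the limit.\<close>

lemma parseval:
  fixes a :: "nat \<Rightarrow> 'a::complex_hilbert_space"
  assumes sm: "summable (\<lambda>n. norm (a n))"
  shows "summable (\<lambda>n. (norm (a n))\<^sup>2)"
    and "((\<lambda>t. (norm (\<Sum>n. cis (- (real n * t)) *\<^sub>C a n))\<^sup>2)
    has_integral (2 * pi * (\<Sum>n. (norm (a n))\<^sup>2))) {0..2 * pi}"
proof -
  define B where "B = (\<Sum>n. norm (a n))"
  have part: "(\<Sum>n<N. norm (a n)) \<le> B" for N
    unfolding B_def by (intro sum_le_suminf sm) auto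
  show sq: "summable (\<lambda>n. (norm (a n))\<^sup>2)"
  proof (rule summable_comparison_test'[OF summable_mult[OF sm, of B]])
    fix n
    have "norm (a n) \<le> B" using part[of "Suc n"] sum_nonneg[of "{..<n}" "\<lambda>n. norm (a n)"] by auto
    then show "norm ((norm (a n))\<^sup>2) \<le> B * norm (a n)"
      by (simp add: power2_eq_square mult_right_mono)
  qed
  let ?f = "\<lambda>N t. (norm (\<Sum>n<N. cis (- (real n * t)) *\<^sub>C a n))\<^sup>2"
  let ?g = "\<lambda>t. (norm (\<Sum>n. cis (- (real n * t)) *\<^sub>C a n))\<^sup>2"
  have smt: "summable (\<lambda>n. cis (- (real n * t)) *\<^sub>C a n)" for t
    by (rule summable_norm_cancel) (simp add: norm_scaleC sm)
  have int: "?f N integrable_on {0..2 * pi}" for N using parseval_finite by blast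
  have bound: "norm (?f N t) \<le> B\<^sup>2" for N t
  proof -
    have "norm (\<Sum>n<N. cis (- (real n * t)) *\<^sub>C a n) \<le> (\<Sum>n<N. norm (a n))"
      by (rule order_trans[OF norm_sum]) (simp add: norm_scaleC)
    then have "norm (\<Sum>n<N. cis (- (real n * t)) *\<^sub>C a n) \<le> B" using part[of N] by linarith
    then show ?thesis by (simp add: power_mono)
  qed
  have lim: "(\<lambda>N. ?f N t) \<longlonglongrightarrow> ?g t" for t
    by (intro tendsto_intros summable_LIMSEQ smt)
  note dc = dominated_convergence[OF int integrable_const_ivl bound lim]
  have "(\<lambda>N. 2 * pi * (\<Sum>n<N. (norm (a n))\<^sup>2)) \<longlonglongrightarrow> 2 * pi * (\<Sum>n. (norm (a n))\<^sup>2)"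
    by (intro tendsto_intros summable_LIMSEQ sq)
  moreover have "integral {0..2 * pi} (?f N) = 2 * pi * (\<Sum>n<N. (norm (a n))\<^sup>2)" for N
    using parseval_finite by (rule integral_unique)
  ultimately have "integral {0..2 * pi} ?g = 2 * pi * (\<Sum>n. (norm (a n))\<^sup>2)"
    using LIMSEQ_unique[OF dc(2)] by simp
  then show "(?g has_integral (2 * pi * (\<Sum>n. (norm (a n))\<^sup>2))) {0..2 * pi}"
    using dc by (simp add: has_integral_integrable_integral)
qed

section \<open>Resolvents of power-bounded operators\<close>

locale power_bounded_operator =
  fixes T :: "'a::complex_hilbert_space \<Rightarrow> 'a" and K :: real
  assumes bounded_clinear: "bounded_clinear T"
    and norm_power_le: "norm ((T ^^ n) x) \<le> K * norm x"
    and K_pos: "K > 0"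
begin

lemma bounded_linear_T: "bounded_linear T"
  using bounded_clinear by (simp add: bounded_clinear_def)

lemma apply_scaleC: "T (a *\<^sub>C x) = a *\<^sub>C T x"
  using bounded_clinear by (simp add: bounded_clinear_def)

text \<open>A vector \<open>w\<close> in the kernel satisfies
  \<open>(T ^^ n) w = (z ^ n) *\<^sub>C w\<close>, whose norm would outgrow the power bound.
  Injectivity lets \<open>resolvent\<close>, defined through \<open>inv\<close>, be computed by
  solving the equation.\<close>

lemma inj_resolvent:
  assumes "cmod z > 1"
  shows "inj (\<lambda>x. z *\<^sub>C x - T x)"
proof (rule injI)
  fix x y assume eq: "z *\<^sub>C x - T x = z *\<^sub>C y - T y"
  define w where "w = x - y"
  have "z *\<^sub>C w - T w = (z *\<^sub>C x - T x) - (z *\<^sub>C y - T y)"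
    unfolding w_def linear_diff[OF bounded_linear.linear[OF bounded_linear_T]]
      linear_diff[OF bounded_linear.linear[OF bounded_linear_scaleC]]
    by simp
  then have w: "T w = z *\<^sub>C w" using eq by simp
  have pow: "(T ^^ n) w = (z ^ n) *\<^sub>C w" for n
    by (induction n) (auto simp: scaleC_one apply_scaleC w scaleC_scaleC mult.commute)
  show "x = y"
  proof (rule ccontr)
    assume "x \<noteq> y"
    then have "norm w > 0" by (simp add: w_def)
    obtain n where n: "K < cmod z ^ n" using real_arch_pow[OF assms] by blast
    have "cmod z ^ n * norm w \<le> K * norm w"
      using norm_power_le[of n w] by (simp add: pow norm_scaleC norm_power)
    with n \<open>norm w > 0\<close> show False by simp
  qed
qed

lemma resolvent_eqI:
  assumes "cmod z > 1" "z *\<^sub>C y - T y = x"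
  shows "resolvent z T x = y"
  unfolding resolvent_def using inv_f_eq[OF inj_resolvent[OF assms(1)], of y x] assms(2) by simp

section \<open>Series expansion of resolvent powers\<close>

definition resolvent_term :: "complex \<Rightarrow> nat \<Rightarrow> nat \<Rightarrow> 'a \<Rightarrow> 'a"
  where "resolvent_term z m n x = (of_nat ((n + m - 1) choose n) / z ^ (n + m)) *\<^sub>C (T ^^ n) x"

lemma norm_resolvent_term:
  "norm (resolvent_term z m n x) =
    real ((n + m - 1) choose n) * (1 / cmod z) ^ (n + m) * norm ((T ^^ n) x)"
  by (simp add: resolvent_term_def norm_scaleC norm_divide norm_power power_one_over)

lemma summable_norm_resolvent_term:
  assumes "cmod z > 1"
  shows "summable (\<lambda>n. norm (resolvent_term z m n x))"
proof (rule summable_comparison_test')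
  show "summable (\<lambda>n. real ((n + m - 1) choose n) * (1 / cmod z) ^ (n + m) * (K * norm x))"
    using resolvent_weight_sums[OF assms, of m] by (intro summable_mult2) (auto simp: sums_iff)
  show "norm (norm (resolvent_term z m n x))
      \<le> real ((n + m - 1) choose n) * (1 / cmod z) ^ (n + m) * (K * norm x)" for n
    by (auto simp: norm_resolvent_term intro!: mult_left_mono norm_power_le)
qed

text \<open>Applying \<open>z - T\<close> to the candidate series for \<open>Suc m\<close> gives the
  series for \<open>m\<close> by Pascal's rule; injectivity then identifies the candidate with
  \<open>resolvent z T v\<close>. Taken with \<open>m = 0\<close>, the second claim says that
  \<open>z - T\<close> is onto.\<close>

lemma resolvent_term_sums_step:
  assumes "cmod z > 1" "(\<lambda>n. resolvent_term z m n x) sums v"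
  shows "(\<lambda>n. resolvent_term z (Suc m) n x) sums resolvent z T v"
    and "z *\<^sub>C resolvent z T v - T (resolvent z T v) = v"
proof -
  have z0: "z \<noteq> 0" using assms by auto
  define V where "V = (\<Sum>n. resolvent_term z (Suc m) n x)"
  have V: "(\<lambda>n. resolvent_term z (Suc m) n x) sums V"
    unfolding V_def
    by (rule summable_sums[OF summable_norm_cancel[OF summable_norm_resolvent_term[OF assms(1)]]])
  define g where "g = (\<lambda>n. z *\<^sub>C resolvent_term z (Suc m) n x)"
  define h where "h = (\<lambda>n. T (resolvent_term z (Suc m) n x))"
  have gs: "g sums (z *\<^sub>C V)" unfolding g_def by (rule bounded_linear.sums[OF bounded_linear_scaleC V])
  have hs: "h sums T V" unfolding h_def by (rule bounded_linear.sums[OF bounded_linear_T V])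
  have g: "g n = (of_nat ((n + m) choose n) / z ^ (n + m)) *\<^sub>C (T ^^ n) x" for n
    using z0 by (simp add: g_def resolvent_term_def scaleC_scaleC field_simps)
  have h: "h n = (of_nat ((n + m) choose n) / z ^ (Suc n + m)) *\<^sub>C (T ^^ Suc n) x" for n
    by (simp add: h_def resolvent_term_def apply_scaleC)
  have "(\<lambda>n. g (Suc n) - h n) sums (z *\<^sub>C V - g 0 - T V)"
    using sums_diff[OF _ hs] gs sums_Suc_iff[of g] by auto
  moreover have "g (Suc n) - h n = resolvent_term z m (Suc n) x" for n
  proof -
    have "g (Suc n) - h n = (of_nat ((Suc n + m) choose Suc n) / z ^ (Suc n + m)
        - of_nat ((n + m) choose n) / z ^ (Suc n + m)) *\<^sub>C (T ^^ Suc n) x"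
      unfolding g h by (simp only: scaleC_diff_left)
    also have "of_nat ((Suc n + m) choose Suc n) / z ^ (Suc n + m)
        - of_nat ((n + m) choose n) / z ^ (Suc n + m)
      = of_nat ((n + m) choose Suc n) / z ^ (Suc n + m)"
      by (simp add: add_divide_distrib)
    finally show ?thesis by (simp add: resolvent_term_def)
  qed
  moreover have "g 0 = resolvent_term z m 0 x" by (simp add: g resolvent_term_def)
  ultimately have "(\<lambda>n. resolvent_term z m n x) sums (z *\<^sub>C V - T V)"
    using sums_Suc[of "\<lambda>n. resolvent_term z m n x" "z *\<^sub>C V - g 0 - T V"] by (simp add: algebra_simps)
  then have eq: "z *\<^sub>C V - T V = v" using assms(2) sums_unique2 by blast
  then have "resolvent z T v = V" by (rule resolvent_eqI[OF assms(1)])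
  then show "(\<lambda>n. resolvent_term z (Suc m) n x) sums resolvent z T v"
    and "z *\<^sub>C resolvent z T v - T (resolvent z T v) = v"
    using V eq by auto
qed

lemma resolvent_term_0_sums: "(\<lambda>n. resolvent_term z 0 n x) sums x"
proof -
  \<comment> \<open>Truncated subtraction turns the coefficient into
    \<open>(n - 1) choose n\<close>, which vanishes except at \<open>n = 0\<close>.\<close>
  have "(\<lambda>n. resolvent_term z 0 n x) = (\<lambda>n. if n = 0 then x else 0)"
    by (auto simp: fun_eq_iff resolvent_term_def scaleC_one scaleC_zero binomial_eq_0)
  then show ?thesis using sums_single[of 0 "\<lambda>_. x"] by simp
qed

lemma resolvent_power_sums:
  assumes "cmod z > 1"
  shows "(\<lambda>n. resolvent_term z m n x) sums (resolvent z T ^^ m) x"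
  by (induction m) (auto simp: resolvent_term_0_sums intro: resolvent_term_sums_step(1)[OF assms])

lemma norm_resolvent_power_le:
  assumes "cmod z > 1"
    and "(\<lambda>n. real ((n + m - 1) choose n) * (1 / cmod z) ^ (n + m) * b n) sums B"
    and "\<And>n. norm ((T ^^ n) x) \<le> b n"
  shows "norm ((resolvent z T ^^ m) x) \<le> B"
proof -
  have "norm (\<Sum>n. resolvent_term z m n x) \<le> (\<Sum>n. norm (resolvent_term z m n x))"
    by (intro summable_norm summable_norm_resolvent_term assms)
  also have "\<dots> \<le> (\<Sum>n. real ((n + m - 1) choose n) * (1 / cmod z) ^ (n + m) * b n)"
    using assms summable_norm_resolvent_term[of z m x]
    by (intro suminf_le) (auto simp: sums_iff norm_resolvent_term intro!: mult_left_mono)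
  finally show ?thesis using assms(2) resolvent_power_sums[OF assms(1), of m x] by (simp add: sums_iff)
qed

lemma norm_resolvent_power_le_power_bound:
  assumes "cmod z > 1"
  shows "norm ((resolvent z T ^^ m) x) \<le> K / (cmod z - 1) ^ m * norm x"
  using norm_resolvent_power_le[OF assms sums_mult2[OF resolvent_weight_sums[OF assms]] norm_power_le]
  by simp

text \<open>By definition \<open>resolvent\<close> is merely an inverse function, so linearity is
  read off the series, term by term.\<close>

lemma bounded_linear_resolvent_power:
  assumes "cmod z > 1"
  shows "bounded_linear (resolvent z T ^^ m)"
proof (rule bounded_linear_intro)
  fix x y :: 'a and r :: real
  note lin = bounded_linear_compose[OF bounded_linear_scaleC bounded_linear_funpow[OF bounded_linear_T]]
  have "resolvent_term z m n (x + y) = resolvent_term z m n x + resolvent_term z m n y" for n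
    unfolding resolvent_term_def by (rule linear_add[OF bounded_linear.linear[OF lin]])
  then show "(resolvent z T ^^ m) (x + y) = (resolvent z T ^^ m) x + (resolvent z T ^^ m) y"
    using resolvent_power_sums[OF assms, of m "x + y"]
      sums_add[OF resolvent_power_sums[OF assms, of m x] resolvent_power_sums[OF assms, of m y]]
    by (simp add: sums_iff)
  have "resolvent_term z m n (r *\<^sub>R x) = r *\<^sub>R resolvent_term z m n x" for n
    unfolding resolvent_term_def by (rule linear_scale[OF bounded_linear.linear[OF lin]])
  then show "(resolvent z T ^^ m) (r *\<^sub>R x) = r *\<^sub>R (resolvent z T ^^ m) x"
    using resolvent_power_sums[OF assms, of m "r *\<^sub>R x"]
      sums_scaleR_right[OF resolvent_power_sums[OF assms, of m x], of r]
    by (simp add: sums_iff)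
  show "norm ((resolvent z T ^^ m) x) \<le> norm x * (K / (cmod z - 1) ^ m)"
    using norm_resolvent_power_le_power_bound[OF assms, of m x] by (simp add: mult.commute)
qed

lemma resolvent_commute:
  assumes "cmod z > 1" "bounded_clinear S" "S \<circ> T = T \<circ> S"
  shows "resolvent z T (S x) = S (resolvent z T x)"
proof (rule resolvent_eqI[OF assms(1)])
  have "z *\<^sub>C resolvent z T x - T (resolvent z T x) = x"
    by (rule resolvent_term_sums_step(2)[OF assms(1) resolvent_term_0_sums])
  moreover have "S (z *\<^sub>C y - T y) = z *\<^sub>C S y - T (S y)" for y
    using assms(2,3) linear_diff[OF bounded_linear.linear, of S] unfolding bounded_clinear_def
    by (metis comp_apply)
  ultimately show "z *\<^sub>C S (resolvent z T x) - T (S (resolvent z T x)) = S x" by metis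
qed

section \<open>Parseval on circles and decay from the resolvent bound\<close>

lemma norm_resolvent_power_circle:
  fixes r t :: real
  assumes "r > 1"
  shows "norm ((resolvent (of_real r * cis t) T ^^ m) x) =
    norm (\<Sum>n. cis (- (real n * t)) *\<^sub>C
      ((real ((n + m - 1) choose n) * (1 / r) ^ (n + m)) *\<^sub>R (T ^^ n) x))"
proof -
  define z where "z = of_real r * cis t"
  have z: "cmod z > 1" using assms by (simp add: z_def norm_mult)
  define a where "a n = (real ((n + m - 1) choose n) * (1 / r) ^ (n + m)) *\<^sub>R (T ^^ n) x" for n
  \<comment> \<open>The unimodular factor \<open>cis (m * t)\<close> removes the part of the phase
    of \<open>z ^ (n + m)\<close> that does not depend on \<open>n\<close>. What remains is a
    Fourier series with coefficients \<open>a n\<close>, of the same norm.\<close>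
  have "cis (real m * t) *\<^sub>C resolvent_term z m n x = cis (- (real n * t)) *\<^sub>C a n" for n
  proof -
    have "cis (real m * t) * (of_nat ((n + m - 1) choose n) / z ^ (n + m))
        = cis (- (real n * t)) * of_real (real ((n + m - 1) choose n) * (1 / r) ^ (n + m))"
      using assms
      by (simp add: z_def power_mult_distrib Complex.DeMoivre power_one_over field_simps
          cis_mult[symmetric] cis_divide[symmetric] flip: cis_inverse)
    then show ?thesis
      by (simp add: resolvent_term_def a_def scaleR_scaleC scaleC_scaleC)
  qed
  then have "(\<lambda>n. cis (- (real n * t)) *\<^sub>C a n) sums (cis (real m * t) *\<^sub>C (resolvent z T ^^ m) x)"
    using bounded_linear.sums[OF bounded_linear_scaleC resolvent_power_sums[OF z, of m x], of "cis (real m * t)"]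
    by simp
  then have "(\<Sum>n. cis (- (real n * t)) *\<^sub>C a n) = cis (real m * t) *\<^sub>C (resolvent z T ^^ m) x"
    by (simp add: sums_iff)
  then show ?thesis by (simp add: a_def z_def norm_scaleC)
qed

lemma parseval_resolvent_power:
  fixes r :: real
  assumes "r > 1"
  shows "summable (\<lambda>n. (real ((n + m - 1) choose n) * (1 / r) ^ (n + m) * norm ((T ^^ n) x))\<^sup>2)"
    and "((\<lambda>t. (norm ((resolvent (of_real r * cis t) T ^^ m) x))\<^sup>2) has_integral
      2 * pi * (\<Sum>n. (real ((n + m - 1) choose n) * (1 / r) ^ (n + m) * norm ((T ^^ n) x))\<^sup>2)) {0..2 * pi}"
proof -
  define a where "a n = (real ((n + m - 1) choose n) * (1 / r) ^ (n + m)) *\<^sub>R (T ^^ n) x" for n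
  have na: "norm (a n) = real ((n + m - 1) choose n) * (1 / r) ^ (n + m) * norm ((T ^^ n) x)" for n
    using assms by (simp add: a_def)
  have "summable (\<lambda>n. norm (a n))"
    using summable_norm_resolvent_term[of "of_real r" m x] assms
    by (simp add: na norm_resolvent_term)
  from parseval[OF this]
  show "summable (\<lambda>n. (real ((n + m - 1) choose n) * (1 / r) ^ (n + m) * norm ((T ^^ n) x))\<^sup>2)"
    and "((\<lambda>t. (norm ((resolvent (of_real r * cis t) T ^^ m) x))\<^sup>2) has_integral
      2 * pi * (\<Sum>n. (real ((n + m - 1) choose n) * (1 / r) ^ (n + m) * norm ((T ^^ n) x))\<^sup>2)) {0..2 * pi}"
    unfolding na norm_resolvent_power_circle[OF assms] by (simp_all add: a_def)
qed

text \<open>Parseval on both sides turns a pointwise estimate on the circle into one between square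
  sums; for the first resolvent power, power-boundedness leaves a geometric series of sum
  \<open>1 / (r - 1)\<close>.\<close>

lemma square_sum_decay:
  fixes r A :: real
  assumes "r > 1" and S: "bounded_clinear S" "S \<circ> T = T \<circ> S"
    and A: "\<And>z y. cmod z = r \<Longrightarrow> norm ((resolvent z T ^^ k) (S y)) \<le> A * norm y" "A \<ge> 0"
  shows "(\<Sum>n<N. (real ((n + k) choose n) * (1 / r) ^ (n + Suc k) * norm ((T ^^ n) (S x)))\<^sup>2)
    \<le> (A * K * norm x)\<^sup>2 / (r - 1)"
proof -
  let ?b = "\<lambda>n. (real ((n + Suc k - 1) choose n) * (1 / r) ^ (n + Suc k) * norm ((T ^^ n) (S x)))\<^sup>2"
  let ?a = "\<lambda>n. (real ((n + 1 - 1) choose n) * (1 / r) ^ (n + 1) * norm ((T ^^ n) x))\<^sup>2"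
  note b = parseval_resolvent_power[OF assms(1), of "Suc k" "S x"]
  note a = parseval_resolvent_power[OF assms(1), of 1 x]
  \<comment> \<open>Commuting \<open>S\<close> past one resolvent allows the hypothesis to be
    applied at \<open>resolvent z T x\<close>.\<close>
  have "norm ((resolvent z T ^^ Suc k) (S x)) \<le> A * norm ((resolvent z T ^^ 1) x)" if "cmod z = r" for z
    using A(1)[OF that, of "resolvent z T x"] resolvent_commute[of z S x] S assms(1) that
    by (simp add: funpow_swap1)
  then have "2 * pi * suminf ?b \<le> A\<^sup>2 * (2 * pi * suminf ?a)"
    using assms(1) A(2)
    by (intro has_integral_le[OF b(2) has_integral_mult_right[OF a(2)]])
      (auto simp: power_mult_distrib[symmetric] norm_mult intro!: power_mono)
  then have "suminf ?b \<le> A\<^sup>2 * suminf ?a" by simp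
  moreover have "suminf ?a \<le> (K * norm x)\<^sup>2 / (r - 1)"
  proof (rule sums_le[OF _ summable_sums[OF a(1)]])
    show "(\<lambda>n. real ((n + 1 - 1) choose n) * (1 / r) ^ (n + 1) * (K * norm x)\<^sup>2) sums ((K * norm x)\<^sup>2 / (r - 1))"
      using sums_mult2[OF resolvent_weight_sums[OF assms(1), of 1]] by simp
    fix n
    have "((1 / r) ^ (n + 1))\<^sup>2 \<le> (1 / r) ^ (n + 1)"
      unfolding power2_eq_square using assms(1) by (intro mult_left_le power_le_one) auto
    moreover have "(norm ((T ^^ n) x))\<^sup>2 \<le> (K * norm x)\<^sup>2" by (intro power_mono norm_power_le) auto
    ultimately have "((1 / r) ^ (n + 1))\<^sup>2 * (norm ((T ^^ n) x))\<^sup>2 \<le> (1 / r) ^ (n + 1) * (K * norm x)\<^sup>2"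
      using assms(1) by (intro mult_mono) auto
    then show "?a n \<le> real ((n + 1 - 1) choose n) * (1 / r) ^ (n + 1) * (K * norm x)\<^sup>2"
      by (simp only: add_diff_cancel_right' binomial_n_n of_nat_1 mult_1 power_mult_distrib)
  qed
  ultimately have "suminf ?b \<le> A\<^sup>2 * ((K * norm x)\<^sup>2 / (r - 1))"
    by (meson mult_left_mono order_trans zero_le_power2)
  moreover have "(\<Sum>n<N. ?b n) \<le> suminf ?b" by (rule sum_le_suminf[OF b(1)]) auto
  ultimately show ?thesis by (simp add: power_mult_distrib)
qed

text \<open>
  Power-boundedness replaces the duality argument: every \<open>n < N\<close> gives
  \<open>\<parallel>T\<^sup>N S x\<parallel> \<le> K \<parallel>T\<^sup>n S x\<parallel>\<close>, so a square-sum bound over \<open>n < N\<close> controls the last term.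
\<close>

lemma decay_of_resolvent_bound:
  assumes S: "bounded_clinear S" "S \<circ> T = T \<circ> S" and "N > 0"
    and A: "\<And>z y. cmod z = 1 + 1 / real N \<Longrightarrow> norm ((resolvent z T ^^ k) (S y)) \<le> A * norm y" "A \<ge> 0"
  shows "norm ((T ^^ N) (S x)) \<le> exp 1 * 2 ^ Suc k * fact (Suc k) * K\<^sup>2 * A / real N ^ k * norm x"
proof -
  \<comment> \<open>This radius makes \<open>1 / (r - 1)\<close> equal to \<open>N\<close> while
    \<open>r ^ N\<close> stays at most \<open>exp 1\<close>.\<close>
  define r where "r = 1 + 1 / real N"
  have r: "r > 1" "r \<le> 2" "1 / (r - 1) = real N" using assms(3) by (auto simp: r_def)
  define y where "y n = real ((n + k) choose n) * (1 / r) ^ (n + Suc k) * norm ((T ^^ n) (S x))" for n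
  define D where "D = exp 1 * (2::real) ^ Suc k"
  have D0: "D > 0" by (simp add: D_def)
  \<comment> \<open>Cauchy-Schwarz over \<open>N\<close> terms; together with
    \<open>1 / (r - 1) = N\<close> the right-hand side becomes a square.\<close>
  have "(\<Sum>n<N. y n)\<^sup>2 \<le> (\<Sum>n<N. (y n)\<^sup>2) * real N"
    using sum_squared_le_sum_of_squares[of y "{..<N}"] by simp
  also have "\<dots> \<le> ((A * K * norm x)\<^sup>2 / (r - 1)) * real N"
    unfolding y_def using r(1) S A by (intro mult_right_mono square_sum_decay) (auto simp: r_def)
  also have "\<dots> = (A * K * norm x * real N)\<^sup>2"
    using r(3) by (simp add: power2_eq_square divide_inverse mult_ac)
  finally have up: "(\<Sum>n<N. y n) \<le> A * K * norm x * real N"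
    by (rule power2_le_imp_le) (use A(2) K_pos in auto)
  have low: "real ((n + k) choose n) * norm ((T ^^ N) (S x)) \<le> K * D * y n" if "n < N" for n
  proof -
    have "(T ^^ N) (S x) = (T ^^ (N - n)) ((T ^^ n) (S x))"
      using that funpow_add[of "N - n" n T] by simp
    then have 1: "norm ((T ^^ N) (S x)) \<le> K * norm ((T ^^ n) (S x))" using norm_power_le by simp
    \<comment> \<open>For \<open>n < N\<close> the radial weight costs only the constant
      \<open>D\<close>, as \<open>r ^ N \<le> exp 1\<close> and \<open>r \<le> 2\<close>.\<close>
    have "r ^ (n + Suc k) \<le> r ^ (N + Suc k)" using r that by (intro power_increasing) auto
    also have "\<dots> \<le> D"
      unfolding D_def power_add
    proof (rule mult_mono)
      have "r ^ N \<le> exp (1 / real N) ^ N"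
        unfolding r_def by (intro power_mono exp_ge_add_one_self) auto
      also have "\<dots> = exp 1" using assms(3) by (simp add: exp_of_nat_mult[symmetric])
      finally show "r ^ N \<le> exp 1" .
      show "r ^ Suc k \<le> 2 ^ Suc k" using r by (intro power_mono) auto
    qed (use r in auto)
    finally have "1 \<le> D * (1 / r) ^ (n + Suc k)"
      using r(1) by (simp add: power_one_over field_simps del: power_Suc)
    then have "1 * (K * norm ((T ^^ n) (S x))) \<le> D * (1 / r) ^ (n + Suc k) * (K * norm ((T ^^ n) (S x)))"
      using K_pos by (intro mult_right_mono) auto
    with 1 have "norm ((T ^^ N) (S x)) \<le> D * (1 / r) ^ (n + Suc k) * (K * norm ((T ^^ n) (S x)))" by linarith
    then have "real ((n + k) choose n) * norm ((T ^^ N) (S x))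
        \<le> real ((n + k) choose n) * (D * (1 / r) ^ (n + Suc k) * (K * norm ((T ^^ n) (S x))))"
      by (intro mult_left_mono) auto
    then show ?thesis by (simp add: y_def mult_ac)
  qed
  \<comment> \<open>Summed over \<open>n < N\<close>, the binomial weights have order
    \<open>N ^ Suc k\<close>; against the factor \<open>N\<close> in \<open>up\<close> this leaves
    the decay \<open>1 / N ^ k\<close>.\<close>
  have "real N ^ Suc k \<le> fact (Suc k) * (\<Sum>n<N. real ((n + k) choose n))"
  proof -
    obtain M where M: "N = Suc M" using assms(3) by (cases N) auto
    have "(\<Sum>n<N. (n + k) choose n) = (M + Suc k) choose Suc k"
      using sum_negative_binomial[of "Suc k" M] binomial_symmetric[of "Suc k" "M + Suc k"]
      by (simp add: M lessThan_Suc_atMost)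
    then have "N ^ Suc k \<le> fact (Suc k) * (\<Sum>n<N. (n + k) choose n)"
      using power_le_fact_binomial[of M "Suc k"] M by simp
    then have "real (N ^ Suc k) \<le> real (fact (Suc k) * (\<Sum>n<N. (n + k) choose n))"
      by (simp only: of_nat_le_iff)
    then show ?thesis by (simp only: of_nat_mult of_nat_sum of_nat_power of_nat_fact)
  qed
  then have "real N ^ Suc k * norm ((T ^^ N) (S x))
      \<le> fact (Suc k) * (\<Sum>n<N. real ((n + k) choose n)) * norm ((T ^^ N) (S x))"
    by (rule mult_right_mono) auto
  also have "\<dots> = fact (Suc k) * (\<Sum>n<N. real ((n + k) choose n) * norm ((T ^^ N) (S x)))"
    by (simp add: sum_distrib_right mult.assoc)
  also have "\<dots> \<le> fact (Suc k) * (\<Sum>n<N. K * D * y n)"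
    by (intro mult_left_mono sum_mono low) auto
  also have "\<dots> = fact (Suc k) * K * D * (\<Sum>n<N. y n)" by (simp add: sum_distrib_left mult.assoc)
  also have "\<dots> \<le> fact (Suc k) * K * D * (A * K * norm x * real N)"
    using K_pos D0 by (intro mult_left_mono up) auto
  finally have "(real N ^ k * norm ((T ^^ N) (S x))) * real N
      \<le> (D * fact (Suc k) * K\<^sup>2 * A * norm x) * real N"
    by (simp add: power2_eq_square mult_ac)
  then have "real N ^ k * norm ((T ^^ N) (S x)) \<le> D * fact (Suc k) * K\<^sup>2 * A * norm x"
    using assms(3) by (simp only: mult_le_cancel_right_pos of_nat_0_less_iff)
  then show ?thesis using assms(3) by (simp add: D_def field_simps del: fact_Suc power_Suc)
qed

section \<open>The resolvent bound from decay\<close>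

lemma resolvent_bound_of_decay:
  fixes f :: "real \<Rightarrow> real" and \<alpha> c F :: real and k n\<^sub>1 :: nat
  assumes S: "bounded_linear S" and k: "k \<ge> 1" "real k - 1 \<le> \<alpha>" "\<alpha> < real k"
    and pos: "\<And>t. t > 0 \<Longrightarrow> f t > 0" and n1: "n\<^sub>1 \<ge> 1"
    and mono: "\<And>t s. real n\<^sub>1 \<le> t \<Longrightarrow> t \<le> s \<Longrightarrow> f t \<le> f s"
    and growth: "\<And>t s. real n\<^sub>1 \<le> t \<Longrightarrow> t \<le> s \<Longrightarrow> f s \<le> f t * (s / t) powr \<alpha>"
    and decay: "\<And>n x. n\<^sub>1 \<le> n \<Longrightarrow> norm ((T ^^ n) (S x)) \<le> c / f (real n) * norm x" and c: "c \<ge> 0"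
    and F: "\<And>t. 0 < t \<Longrightarrow> t \<le> real n\<^sub>1 \<Longrightarrow> f t \<le> F"
  shows "\<exists>M>0. \<forall>z x. cmod z > 1 \<longrightarrow> norm ((resolvent z T ^^ k) (S x))
    \<le> M / ((cmod z - 1) ^ k * f (1 / (cmod z - 1))) * norm x"
proof -
  define L where "L = K * onorm S"
  have L0: "L \<ge> 0" using K_pos onorm_pos_le[OF S] by (simp add: L_def)
  have KS: "K * norm (S x) \<le> L * norm x" for x
    using onorm[OF S, of x] K_pos by (simp add: L_def mult.assoc)
  have TS: "norm ((T ^^ n) (S x)) \<le> L * norm x" for n x
    using norm_power_le[of n "S x"] KS[of x] by linarith
  have \<alpha>0: "\<alpha> \<ge> 0" using k by simp
  have f1: "f (real n\<^sub>1) > 0" "F > 0" using n1 pos[of "real n\<^sub>1"] F[of "real n\<^sub>1"] by auto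
  \<comment> \<open>The first summand serves \<open>n \<ge> n\<^sub>1\<close>, where the decay
    applies, with \<open>2 powr \<alpha>\<close> from replacing \<open>n\<close> by
    \<open>n + 1\<close>; the second serves the earlier \<open>n\<close>, where power-boundedness is
    used.\<close>
  define C where "C = c * 2 powr \<alpha> + L * f (real n\<^sub>1)"
  have C0: "C \<ge> 0" using c L0 f1 by (simp add: C_def)
  define M where "M = L * F + C * (1 + 1 / (real k - \<alpha>)) + 1"
  have M: "M > 0" "L * F \<le> M" "C * (1 + 1 / (real k - \<alpha>)) \<le> M"
  proof -
    have "L * F \<ge> 0" "C * (1 + 1 / (real k - \<alpha>)) \<ge> 0"
      using L0 f1 C0 k by auto
    then show "M > 0" "L * F \<le> M" "C * (1 + 1 / (real k - \<alpha>)) \<le> M" by (auto simp: M_def)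
  qed
  have "norm ((resolvent z T ^^ k) (S x))
      \<le> M / ((cmod z - 1) ^ k * f (1 / (cmod z - 1))) * norm x" if z: "cmod z > 1" for z x
  proof -
    define r where "r = cmod z"
    define s where "s = 1 / (r - 1)"
    have r1: "r > 1" using z by (simp add: r_def)
    have s0: "s > 0" using r1 by (simp add: s_def)
    have fs: "f s > 0" using pos s0 by blast
    have sk: "s ^ k = 1 / (r - 1) ^ k" by (simp add: s_def power_one_over)
    have "norm ((resolvent z T ^^ k) (S x)) \<le> M * s ^ k / f s * norm x"
    \<comment> \<open>Below \<open>n\<^sub>1\<close> neither growth nor monotonicity is available;
      there \<open>f s \<le> F\<close> and power-boundedness give the bound, through the summand
      \<open>L * F\<close> of \<open>M\<close>.\<close>
    proof (cases "s < real n\<^sub>1")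
      case True
      have "norm ((resolvent z T ^^ k) (S x)) \<le> s ^ k * (K * norm (S x))"
        using norm_resolvent_power_le_power_bound[OF z, of k "S x"] by (simp add: sk r_def)
      also have "\<dots> \<le> s ^ k * (L * norm x)" using s0 by (intro mult_left_mono KS) auto
      also have "\<dots> \<le> s ^ k * (M / f s * norm x)"
      proof -
        have "L * f s \<le> L * F" using F[of s] True s0 L0 by (intro mult_left_mono) auto
        then have "L \<le> M / f s" using fs M by (simp add: field_simps)
        then show ?thesis using s0 by (intro mult_left_mono mult_right_mono) auto
      qed
      finally show ?thesis by (simp add: mult_ac)
    next
      case False
      define u where "u n = 1 + (if real n + 1 \<le> s then (s / (real n + 1)) powr \<alpha> else 0)" for n
      have "f s * norm ((T ^^ n) (S x)) \<le> C * u n * norm x" for n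
      proof (cases "n\<^sub>1 \<le> n")
        case n: True
        have fn: "f (real n) > 0" using pos n n1 by simp
        have 1: "f s * norm ((T ^^ n) (S x)) \<le> f s * (c / f (real n) * norm x)"
          using fs by (intro mult_left_mono decay n) auto
        have 2: "f s / f (real n) \<le> 2 powr \<alpha> * u n"
        proof (cases "s \<le> real n")
          case True
          have "f s \<le> f (real n)" using mono[of s "real n"] True False by simp
          then have "f s / f (real n) \<le> 1 * 1" using fn by simp
          also have "\<dots> \<le> 2 powr \<alpha> * u n"
            using \<alpha>0 by (intro mult_mono) (auto simp: u_def ge_one_powr_ge_zero)
          finally show ?thesis .
        next
          case ns: False
          have n0: "n \<ge> 1" using n n1 by simp
          have "f s / f (real n) \<le> (s / real n) powr \<alpha>"
            using growth[of "real n" s] ns n fn by (simp add: field_simps)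
          also have "\<dots> \<le> (2 * (s / (real n + 1))) powr \<alpha>"
            using n0 s0 \<alpha>0 by (intro powr_mono2) (auto simp: field_simps)
          also have "\<dots> = 2 powr \<alpha> * (s / (real n + 1)) powr \<alpha>"
            by (rule powr_mult)
          also have "\<dots> \<le> 2 powr \<alpha> * u n"
          proof (intro mult_left_mono)
            \<comment> \<open>If \<open>n < s < n + 1\<close>, the quotient is below
              \<open>1\<close> and is absorbed by the summand \<open>1\<close> of
              \<open>u n\<close>.\<close>
            show "(s / (real n + 1)) powr \<alpha> \<le> u n"
            proof (cases "real n + 1 \<le> s")
              case False
              then have "(s / (real n + 1)) powr \<alpha> \<le> 1 powr \<alpha>"
                using s0 \<alpha>0 by (intro powr_mono2) auto
              then show ?thesis using False by (simp add: u_def)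
            qed (simp add: u_def)
          qed auto
          finally show ?thesis .
        qed
        have "f s * (c / f (real n) * norm x) = c * norm x * (f s / f (real n))" by simp
        also have "\<dots> \<le> c * norm x * (2 powr \<alpha> * u n)" using c by (intro mult_left_mono 2) auto
        also have "\<dots> = (c * 2 powr \<alpha>) * u n * norm x" by simp
        also have "\<dots> \<le> C * u n * norm x"
          using L0 f1 by (intro mult_right_mono) (auto simp: C_def u_def)
        finally show ?thesis using 1 by linarith
      next
        case n: False
        then have ns: "real n + 1 \<le> real n\<^sub>1" by linarith
        \<comment> \<open>As \<open>n + 1 \<le> n\<^sub>1 \<le> s\<close>, the ratio
          \<open>s / n\<^sub>1\<close> may be enlarged to \<open>s / (n + 1)\<close>, the one
          occurring in \<open>u n\<close>.\<close>
        have "f s \<le> f (real n\<^sub>1) * (s / real n\<^sub>1) powr \<alpha>" using growth False by simp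
        also have "\<dots> \<le> f (real n\<^sub>1) * (s / (real n + 1)) powr \<alpha>"
          using ns s0 \<alpha>0 f1 by (intro mult_left_mono powr_mono2 divide_left_mono) auto
        also have "\<dots> \<le> f (real n\<^sub>1) * u n" using f1 ns False by (intro mult_left_mono) (auto simp: u_def)
        finally have "f s * norm ((T ^^ n) (S x)) \<le> (f (real n\<^sub>1) * u n) * (L * norm x)"
          using TS f1 by (intro mult_mono) (auto simp: u_def)
        also have "\<dots> = (L * f (real n\<^sub>1)) * u n * norm x" by simp
        also have "\<dots> \<le> C * u n * norm x"
          using c by (intro mult_right_mono) (auto simp: C_def u_def)
        finally show ?thesis .
      qed
      then have bound: "norm ((T ^^ n) (S x)) \<le> u n * (C / f s * norm x)" for n
        using fs by (simp add: field_simps)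
      obtain B where B: "(\<lambda>n. real ((n + k - 1) choose n) * (1 / r) ^ (n + k) * u n) sums B"
        "B \<le> (1 + 1 / (real k - \<alpha>)) * s ^ k"
        unfolding u_def by (rule weighted_series_bound[OF r1 s_def k])
      have "norm ((resolvent z T ^^ k) (S x)) \<le> B * (C / f s * norm x)"
        using sums_mult2[OF B(1), of "C / f s * norm x"]
        by (intro norm_resolvent_power_le[OF z _ bound]) (simp add: r_def mult.assoc)
      also have "\<dots> \<le> ((1 + 1 / (real k - \<alpha>)) * s ^ k) * (C / f s * norm x)"
        using C0 fs by (intro mult_right_mono B) auto
      also have "\<dots> = (C * (1 + 1 / (real k - \<alpha>))) * (s ^ k / f s * norm x)" by (simp add: mult_ac)
      also have "\<dots> \<le> M * (s ^ k / f s * norm x)" using s0 fs by (intro mult_right_mono M) auto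
      finally show ?thesis by (simp add: mult_ac)
    qed
    then show ?thesis unfolding sk by (simp add: s_def r_def)
  qed
  then show ?thesis using M(1) by blast
qed

end

section \<open>Equivalence of decay and resolvent growth\<close>

theorem theorem3p1:
  fixes T S :: "'a::complex_hilbert_space \<Rightarrow> 'a"
    and \<alpha> :: real and k :: nat and f :: "real \<Rightarrow> real"
  assumes "bounded_clinear T" and "power_bounded T"
    and "bounded_clinear S" and "S \<circ> T = T \<circ> S"
    and "\<alpha> > 0" and "k \<ge> 1" and "real k > \<alpha>"
    and "bounded_regularly_varying \<alpha> f"
    and "\<And>b. b > 0 \<Longrightarrow> bdd_above (f ` {0<..b})"
  shows "(\<lambda>n. onorm ((T ^^ n) \<circ> S)) \<in> O(\<lambda>n. 1 / f (real n)) \<longleftrightarrow>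
    (\<exists>M>0. \<forall>z::complex. norm z > 1 \<longrightarrow>
      onorm ((resolvent z T ^^ k) \<circ> S) \<le> M / ((norm z - 1) ^ k * f (1 / (norm z - 1))))"
proof -
  have linT: "bounded_linear T" and linS: "bounded_linear S"
    using assms(1,3) by (auto simp: bounded_clinear_def)
  obtain K\<^sub>0 where K0: "\<And>n. onorm (T ^^ n) \<le> K\<^sub>0"
    using assms(2) unfolding power_bounded_def bdd_above_def by auto
  interpret power_bounded_operator T "max K\<^sub>0 1"
  proof
    fix n x
    have "norm ((T ^^ n) x) \<le> onorm (T ^^ n) * norm x"
      by (rule onorm[OF bounded_linear_funpow[OF linT]])
    also have "\<dots> \<le> max K\<^sub>0 1 * norm x" using K0[of n] by (intro mult_right_mono) auto
    finally show "norm ((T ^^ n) x) \<le> max K\<^sub>0 1 * norm x" .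
  qed (use assms(1) in auto)
  have pos: "f t > 0" if "t > 0" for t
    using assms(8) that unfolding bounded_regularly_varying_def by blast
  have linTS: "bounded_linear ((T ^^ n) \<circ> S)" for n
    unfolding comp_def by (rule bounded_linear_compose[OF bounded_linear_funpow[OF linT] linS])
  have linRS: "bounded_linear ((resolvent z T ^^ k) \<circ> S)" if "cmod z > 1" for z
    unfolding comp_def
    by (rule bounded_linear_compose[OF bounded_linear_resolvent_power[OF that] linS])
  show ?thesis
  proof
    assume "(\<lambda>n. onorm ((T ^^ n) \<circ> S)) \<in> O(\<lambda>n. 1 / f (real n))"
    then obtain c where c: "c > 0"
      "eventually (\<lambda>n. norm (onorm ((T ^^ n) \<circ> S)) \<le> c * norm (1 / f (real n))) at_top"
      by (elim landau_o.bigE)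
    then obtain n\<^sub>0 where n0: "\<And>n. n \<ge> n\<^sub>0 \<Longrightarrow> \<bar>onorm ((T ^^ n) \<circ> S)\<bar> \<le> c * \<bar>1 / f (real n)\<bar>"
      by (auto simp: eventually_at_top_linorder)
    obtain t\<^sub>0 where t0: "t\<^sub>0 > 0" "mono_on {t\<^sub>0..} f"
      "\<And>t s. t\<^sub>0 \<le> t \<Longrightarrow> t \<le> s \<Longrightarrow> f s \<le> f t * (s / t) powr \<alpha>"
      using bounded_regularly_varying_growth[OF assms(8,5)] by metis
    define n\<^sub>1 where "n\<^sub>1 = max (max n\<^sub>0 1) (nat \<lceil>t\<^sub>0\<rceil>)"
    have n1: "n\<^sub>1 \<ge> 1" "n\<^sub>1 \<ge> n\<^sub>0" "real n\<^sub>1 \<ge> t\<^sub>0"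
      unfolding n\<^sub>1_def using real_nat_ceiling_ge[of t\<^sub>0] by (auto simp: of_nat_max)
    \<comment> \<open>Regular variation gives no upper bound near \<open>0\<close>; boundedness of
      \<open>f\<close> on the initial interval covers the \<open>z\<close> away from the unit
      circle.\<close>
    have "bdd_above (f ` {0<..real n\<^sub>1})" using assms(9) n1(1) by simp
    then obtain F where "\<forall>t\<in>{0<..real n\<^sub>1}. f t \<le> F" unfolding bdd_above_def by blast
    then have F: "f t \<le> F" if "0 < t" "t \<le> real n\<^sub>1" for t using that by simp
    \<comment> \<open>Raising the exponent to \<open>k - 1\<close> when \<alpha> is smaller keeps it
      below \<open>k\<close> and preserves the growth estimate, because
      \<open>s / t \<ge> 1\<close>.\<close>
    define \<beta> where "\<beta> = max \<alpha> (real k - 1)"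
    have "\<exists>M>0. \<forall>z x. cmod z > 1 \<longrightarrow> norm ((resolvent z T ^^ k) (S x))
      \<le> M / ((cmod z - 1) ^ k * f (1 / (cmod z - 1))) * norm x"
    proof (rule resolvent_bound_of_decay[OF linS assms(6) _ _ pos n1(1) _ _ _ _ F])
      show "real k - 1 \<le> \<beta>" "\<beta> < real k" using assms(7) by (auto simp: \<beta>_def)
      show "0 \<le> c" using c by simp
      show "f t \<le> f s" if "real n\<^sub>1 \<le> t" "t \<le> s" for t s
        using t0(2) that n1(3) by (auto simp: mono_on_def)
      show "f s \<le> f t * (s / t) powr \<beta>" if ts: "real n\<^sub>1 \<le> t" "t \<le> s" for t s
      proof -
        have "t > 0" using ts n1 t0(1) by linarith
        then have "(s / t) powr \<alpha> \<le> (s / t) powr \<beta>" using ts by (intro powr_mono) (auto simp: \<beta>_def)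
        then have "f t * (s / t) powr \<alpha> \<le> f t * (s / t) powr \<beta>"
          using pos[OF \<open>t > 0\<close>] by (intro mult_left_mono) auto
        then show ?thesis using t0(3)[of t s] ts n1 by linarith
      qed
      show "norm ((T ^^ n) (S x)) \<le> c / f (real n) * norm x" if n: "n\<^sub>1 \<le> n" for n x
      proof -
        have "f (real n) > 0" using n n1 pos by simp
        then have "onorm ((T ^^ n) \<circ> S) \<le> c / f (real n)" using n0[of n] n n1 by simp
        then have "onorm ((T ^^ n) \<circ> S) * norm x \<le> c / f (real n) * norm x"
          by (rule mult_right_mono) simp
        then show ?thesis using onorm[OF linTS, of n x] by simp
      qed
    qed
    then obtain M where M: "M > 0" "\<And>z x. cmod z > 1 \<Longrightarrow> norm ((resolvent z T ^^ k) (S x))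
      \<le> M / ((cmod z - 1) ^ k * f (1 / (cmod z - 1))) * norm x" by blast
    have "onorm ((resolvent z T ^^ k) \<circ> S) \<le> M / ((cmod z - 1) ^ k * f (1 / (cmod z - 1)))"
      if "cmod z > 1" for z
    proof (rule onorm_bound)
      show "0 \<le> M / ((cmod z - 1) ^ k * f (1 / (cmod z - 1)))"
        using M(1) that pos[of "1 / (cmod z - 1)"] by simp
    qed (use M(2)[OF that] in simp)
    then show "\<exists>M>0. \<forall>z. cmod z > 1 \<longrightarrow>
      onorm ((resolvent z T ^^ k) \<circ> S) \<le> M / ((cmod z - 1) ^ k * f (1 / (cmod z - 1)))"
      using M(1) by blast
  next
    assume "\<exists>M>0. \<forall>z. cmod z > 1 \<longrightarrow>
      onorm ((resolvent z T ^^ k) \<circ> S) \<le> M / ((cmod z - 1) ^ k * f (1 / (cmod z - 1)))"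
    then obtain M where M: "M > 0" "\<And>z. cmod z > 1 \<Longrightarrow>
      onorm ((resolvent z T ^^ k) \<circ> S) \<le> M / ((cmod z - 1) ^ k * f (1 / (cmod z - 1)))" by blast
    define c where "c = exp 1 * 2 ^ Suc k * fact (Suc k) * (max K\<^sub>0 1)\<^sup>2 * M"
    have "onorm ((T ^^ N) \<circ> S) \<le> c * (1 / f (real N))" if N: "N > 0" for N
    proof (rule onorm_bound)
      have fN: "f (real N) > 0" using pos N by simp
      show "0 \<le> c * (1 / f (real N))" using M fN by (simp add: c_def)
      fix x
      \<comment> \<open>On the circle \<open>cmod z = 1 + 1 / N\<close> the argument
        \<open>1 / (cmod z - 1)\<close> of \<open>f\<close> is \<open>N\<close>, so the resolvent
        bound becomes \<open>M * N ^ k / f N\<close> and the powers of \<open>N\<close>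
        cancel.\<close>
      have "norm ((T ^^ N) (S x)) \<le> exp 1 * 2 ^ Suc k * fact (Suc k) * (max K\<^sub>0 1)\<^sup>2
          * (M * real N ^ k / f (real N)) / real N ^ k * norm x"
      proof (rule decay_of_resolvent_bound[OF assms(3,4) N])
        fix z :: complex and y :: 'a assume z: "cmod z = 1 + 1 / real N"
        then have z1: "cmod z > 1" using N by simp
        have "onorm ((resolvent z T ^^ k) \<circ> S) \<le> M * real N ^ k / f (real N)"
          using M(2)[OF z1] N by (simp add: z power_one_over)
        then have "onorm ((resolvent z T ^^ k) \<circ> S) * norm y \<le> M * real N ^ k / f (real N) * norm y"
          by (rule mult_right_mono) simp
        then show "norm ((resolvent z T ^^ k) (S y)) \<le> M * real N ^ k / f (real N) * norm y"
          using onorm[OF linRS[OF z1], of y] by simp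
      qed (use M fN in auto)
      also have "\<dots> = c * (1 / f (real N)) * norm x"
        using N by (simp add: c_def del: fact_Suc power_Suc)
      finally show "norm (((T ^^ N) \<circ> S) x) \<le> c * (1 / f (real N)) * norm x" by simp
    qed
    then show "(\<lambda>n. onorm ((T ^^ n) \<circ> S)) \<in> O(\<lambda>n. 1 / f (real n))"
      using onorm_pos_le[OF linTS] pos
      by (intro bigoI[of _ c] eventually_mono[OF eventually_gt_at_top[of 0]]) (simp add: abs_of_pos)
  qed
qed

end
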